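(* Let $a\ge b\ge 12$ be integers with $3\mid b$. If the spider $S(a,b,2)$ is $e$-positive, then \[a\ge\begin{cases}3b+3,&\text{if } a\equiv 0\pmod 3,\\[3pt] \dfrac{b}{2}+\dfrac94+\dfrac{\sqrt{12b^2-180b+565}}{4},&\text{if } a\equiv1\pmod 3,\\[6pt] \dfrac b2+\dfrac13+\dfrac{\sqrt{27b^2-54b+112}}{6},&\text{if } a\equiv 2\pmod 3.\end{cases}\] *)

theory Defs
  imports Complex_Main "HOL-Library.FuncSet"
begin

text \<open>Symmetric functions in the countably many variables x_0, x_1, ... (with
rational/real coefficients) are represented by their coefficient functions on
monomials: a monomial x^alpha is given by an exponent function alpha :: nat => nat
with finite support.\<close>

definition monomial_exps :: "(nat \<Rightarrow> nat) set" where
  "monomial_exps = {\<alpha>. finite {i. \<alpha> i \<noteq> 0}}"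

definition proper_colouring :: "'v set \<Rightarrow> ('v \<Rightarrow> 'v \<Rightarrow> bool) \<Rightarrow> ('v \<Rightarrow> nat) \<Rightarrow> bool" where
  "proper_colouring V adj \<kappa> \<longleftrightarrow>
     \<kappa> \<in> V \<rightarrow>\<^sub>E UNIV \<and> (\<forall>u\<in>V. \<forall>v\<in>V. adj u v \<longrightarrow> \<kappa> u \<noteq> \<kappa> v)"

text \<open>Coefficient of x^alpha in Stanley's chromatic symmetric function
X_G = sum over proper colourings kappa of prod_{v in V} x_{kappa v}.\<close>

definition chrom_coeff :: "'v set \<Rightarrow> ('v \<Rightarrow> 'v \<Rightarrow> bool) \<Rightarrow> (nat \<Rightarrow> nat) \<Rightarrow> nat" where
  "chrom_coeff V adj \<alpha> =
     card {\<kappa>. proper_colouring V adj \<kappa> \<and> (\<forall>i. card {v\<in>V. \<kappa> v = i} = \<alpha> i)}"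

definition partitions_of :: "nat \<Rightarrow> nat list set" where
  "partitions_of n = {ps. sorted_wrt (\<ge>) ps \<and> 0 \<notin> set ps \<and> sum_list ps = n}"

text \<open>Coefficient of x^alpha in the elementary symmetric function
e_lambda = e_{lambda_1} * ... * e_{lambda_l}, where
e_k = sum over k-subsets S of nat of prod_{j in S} x_j: it counts the tuples
(S_1,...,S_l) of finite sets with card S_i = lambda_i in which each colour j
occurs in exactly alpha j of the S_i.\<close>

definition elem_coeff :: "nat list \<Rightarrow> (nat \<Rightarrow> nat) \<Rightarrow> nat" where
  "elem_coeff ps \<alpha> =
     card {Ss :: nat set list. length Ss = length ps \<and>
             (\<forall>i<length ps. finite (Ss ! i) \<and> card (Ss ! i) = ps ! i) \<and>
             (\<forall>j. card {i. i < length ps \<and> j \<in> Ss ! i} = \<alpha> j)}"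

text \<open>e-positivity: X_G is a nonnegative linear combination of the e_lambda,
lambda ranging over the partitions of |V| (X_G is homogeneous of degree |V|).\<close>

definition e_positive :: "'v set \<Rightarrow> ('v \<Rightarrow> 'v \<Rightarrow> bool) \<Rightarrow> bool" where
  "e_positive V adj \<longleftrightarrow>
     (\<exists>c :: nat list \<Rightarrow> real. (\<forall>ps\<in>partitions_of (card V). c ps \<ge> 0) \<and>
        (\<forall>\<alpha>\<in>monomial_exps.
           real (chrom_coeff V adj \<alpha>) =
           (\<Sum>ps\<in>partitions_of (card V). c ps * real (elem_coeff ps \<alpha>))))"

text \<open>The spider S(a,b,c): a centre (0,0) with three legs (paths) of a, b, c
vertices attached; leg k consists of the vertices (k,1),...,(k,len_k), where
(k,1) is adjacent to the centre and (k,j) is adjacent to (k,j+1).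
It has a+b+c+1 vertices.\<close>

definition spider_verts :: "nat \<Rightarrow> nat \<Rightarrow> nat \<Rightarrow> (nat \<times> nat) set" where
  "spider_verts a b c = insert (0,0)
     {(k,j). 1 \<le> j \<and> ((k = 1 \<and> j \<le> a) \<or> (k = 2 \<and> j \<le> b) \<or> (k = 3 \<and> j \<le> c))}"

definition spider_edge :: "nat \<times> nat \<Rightarrow> nat \<times> nat \<Rightarrow> bool" where
  "spider_edge u v \<longleftrightarrow>
     (fst u \<noteq> 0 \<and> fst v = fst u \<and> snd v = snd u + 1) \<or>
     (u = (0,0) \<and> fst v \<noteq> 0 \<and> snd v = 1)"

definition spider_adj :: "nat \<Rightarrow> nat \<Rightarrow> nat \<Rightarrow> nat \<times> nat \<Rightarrow> nat \<times> nat \<Rightarrow> bool" where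
  "spider_adj a b c u v \<longleftrightarrow>
     u \<in> spider_verts a b c \<and> v \<in> spider_verts a b c \<and> (spider_edge u v \<or> spider_edge v u)"

definition spider_e_positive :: "nat \<Rightarrow> nat \<Rightarrow> nat \<Rightarrow> bool" where
  "spider_e_positive a b c \<longleftrightarrow> e_positive (spider_verts a b c) (spider_adj a b c)"

end

theory Submission
  imports Defs
    "HOL-Computational_Algebra.Polynomial_FPS"
    "HOL-Computational_Algebra.Fundamental_Theorem_Algebra"
begin

text \<open>
  Choose complex numbers \<open>x\<^sub>i\<close> with \<open>\<Prod>(1 + x\<^sub>i z) = 1 + z\<^sup>3 + v z\<^sup>p\<close>, where \<open>p = 4\<close> or \<open>p = 5\<close>, and
  substitute them for the variables. Every \<open>e\<^sub>\<lambda>\<close> becomes zero or a power of \<open>v\<close>, so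
  e-positivity forces all coefficients of the resulting polynomial in \<open>v\<close> to be nonnegative.

  Writing \<open>P\<^sub>n\<close> for the specialised chromatic symmetric function of the path on \<open>n\<close> vertices,
  \<open>\<Sum>P\<^sub>n z\<^sup>n = E(z) / (E(z) - z E'(z))\<close>, and since \<open>P\<^sub>1 = P\<^sub>2 = 0\<close> the spider \<open>S(a,b,2)\<close> specialises to
  \<open>P\<^bsub>a+b+3\<^esub> - P\<^bsub>a+1\<^esub> P\<^bsub>b+2\<^esub> - P\<^bsub>a+2\<^esub> P\<^bsub>b+1\<^esub>\<close>. The three bounds come from the following coefficients,
  each of which is a power of two times a polynomial in \<open>a\<close> and \<open>b\<close>: for \<open>a \<equiv> 2\<close> that of
  \<open>e\<^sub>4\<^sup>2 e\<^sub>3\<^sup>m\<close>, for \<open>a \<equiv> 1\<close> that of \<open>e\<^sub>5\<^sup>2 e\<^sub>3\<^sup>m\<close>, and for \<open>a \<equiv> 0\<close> that of \<open>e\<^sub>4\<^sup>3 e\<^sub>3\<^sup>m\<close>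
  (negative when \<open>a \<le> 2b + 3\<close>) together with that of \<open>e\<^sub>4\<^sup>6 e\<^sub>3\<^sup>m\<close> (negative when
  \<open>2b + 6 \<le> a \<le> 3b\<close>).
\<close>

subsection \<open>Evaluating symmetric functions at finitely many variables\<close>

text \<open>Double counting by the value of \<open>h\<close>. It turns a sum of counting
  coefficients into a sum over the counted objects, on both the chromatic and the elementary
  side.\<close>

lemma sum_card_fibres:
  fixes w :: "'b \<Rightarrow> 'c::comm_semiring_1"
  assumes "finite S" "finite T" "h ` S \<subseteq> T"
  shows "(\<Sum>t\<in>T. of_nat (card {s\<in>S. h s = t}) * w t) = (\<Sum>s\<in>S. w (h s))"
proof -
  have "(\<Sum>t\<in>T. of_nat (card {s\<in>S. h s = t}) * w t) = (\<Sum>t\<in>T. \<Sum>s\<in>{s\<in>S. h s = t}. w (h s))"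
    by (intro sum.cong) (auto simp: sum_constant)
  also have "\<dots> = (\<Sum>s\<in>S. w (h s))"
    using assms by (rule sum.group)
  finally show ?thesis .
qed

text \<open>A finite box holding every exponent that can occur when only the first \<open>N\<close>
  variables are kept; written in the form that \<open>finite_set_of_finite_funs\<close>
  expects.\<close>

definition exps_below :: "nat \<Rightarrow> nat \<Rightarrow> (nat \<Rightarrow> nat) set" where
  "exps_below N M = {\<alpha>. \<forall>j. (j \<in> {..<N} \<longrightarrow> \<alpha> j \<in> {..M}) \<and> (j \<notin> {..<N} \<longrightarrow> \<alpha> j = 0)}"

lemma exps_below_support: "\<alpha> \<in> exps_below N M \<Longrightarrow> \<alpha> j \<noteq> 0 \<Longrightarrow> j < N"
  by (rule ccontr) (simp add: exps_below_def)

lemma finite_exps_below: "finite (exps_below N M)"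
  unfolding exps_below_def by (rule finite_set_of_finite_funs) auto

lemma exps_below_subset: "exps_below N M \<subseteq> monomial_exps"
proof
  fix \<alpha> assume "\<alpha> \<in> exps_below N M"
  then have "{i. \<alpha> i \<noteq> 0} \<subseteq> {..<N}"
    by (auto dest: exps_below_support)
  then show "\<alpha> \<in> monomial_exps"
    unfolding monomial_exps_def using finite_subset by blast
qed

definition colourings :: "nat \<Rightarrow> 'v set \<Rightarrow> ('v \<Rightarrow> 'v \<Rightarrow> bool) \<Rightarrow> ('v \<Rightarrow> nat) set" where
  "colourings N V adj =
     {\<kappa> \<in> V \<rightarrow>\<^sub>E {..<N}. \<forall>u\<in>V. \<forall>v\<in>V. adj u v \<longrightarrow> \<kappa> u \<noteq> \<kappa> v}"

lemma finite_colourings: "finite V \<Longrightarrow> finite (colourings N V adj)"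
  unfolding colourings_def by (rule finite_subset[OF Collect_subset]) (auto intro: finite_PiE)

text \<open>Setting all variables from \<open>x N\<close> on to zero leaves the colourings with
  colours below \<open>N\<close>. No colour class exceeds \<open>card V\<close>, so a box of height
  \<open>M\<close> misses nothing.\<close>

lemma sum_chrom_coeff:
  fixes x :: "nat \<Rightarrow> 'c::comm_semiring_1"
  assumes V: "finite V" and M: "card V \<le> M"
  shows "(\<Sum>\<alpha>\<in>exps_below N M. of_nat (chrom_coeff V adj \<alpha>) * (\<Prod>j<N. x j ^ \<alpha> j)) =
         (\<Sum>\<kappa>\<in>colourings N V adj. \<Prod>v\<in>V. x (\<kappa> v))"
proof -
  define h :: "('a \<Rightarrow> nat) \<Rightarrow> nat \<Rightarrow> nat" where "h \<kappa> i = card {v\<in>V. \<kappa> v = i}" for \<kappa> i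
  have range: "h ` colourings N V adj \<subseteq> exps_below N M"
  proof
    fix \<alpha> assume "\<alpha> \<in> h ` colourings N V adj"
    then obtain \<kappa> where \<kappa>: "\<kappa> \<in> colourings N V adj" "\<alpha> = h \<kappa>" by auto
    have "h \<kappa> j \<le> M" for j
      using card_mono[OF V, of "{v\<in>V. \<kappa> v = j}"] M by (auto simp: h_def)
    moreover have "h \<kappa> j = 0" if "\<not> j < N" for j
    proof -
      have "{v\<in>V. \<kappa> v = j} = {}" using \<kappa>(1) that by (auto simp: colourings_def PiE_def Pi_def)
      then show ?thesis by (simp only: h_def card.empty)
    qed
    ultimately show "\<alpha> \<in> exps_below N M" using \<kappa>(2) by (auto simp: exps_below_def)
  qed
  have coeff: "chrom_coeff V adj \<alpha> = card {\<kappa> \<in> colourings N V adj. h \<kappa> = \<alpha>}"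
    if \<alpha>: "\<alpha> \<in> exps_below N M" for \<alpha>
  proof -
    have "\<kappa> v < N" if "\<forall>i. card {v\<in>V. \<kappa> v = i} = \<alpha> i" "v \<in> V" for \<kappa> v
    proof -
      have "card {u\<in>V. \<kappa> u = \<kappa> v} \<noteq> 0" using that(2) V by auto
      then have "\<alpha> (\<kappa> v) \<noteq> 0" using that(1) by simp
      then show ?thesis by (rule exps_below_support[OF \<alpha>])
    qed
    then have "{\<kappa>. proper_colouring V adj \<kappa> \<and> (\<forall>i. card {v\<in>V. \<kappa> v = i} = \<alpha> i)}
        = {\<kappa> \<in> colourings N V adj. h \<kappa> = \<alpha>}"
      by (auto simp: proper_colouring_def colourings_def h_def fun_eq_iff PiE_def Pi_def)
    then show ?thesis by (simp add: chrom_coeff_def)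
  qed
  have weight: "(\<Prod>j<N. x j ^ h \<kappa> j) = (\<Prod>v\<in>V. x (\<kappa> v))" if "\<kappa> \<in> colourings N V adj" for \<kappa>
  proof -
    have "(\<Prod>j<N. x j ^ h \<kappa> j) = (\<Prod>j<N. \<Prod>v\<in>{v\<in>V. \<kappa> v = j}. x (\<kappa> v))"
      by (intro prod.cong) (auto simp: h_def)
    also have "\<dots> = (\<Prod>v\<in>V. x (\<kappa> v))"
      using that by (intro prod.group V) (auto simp: colourings_def PiE_def Pi_def)
    finally show ?thesis .
  qed
  have "(\<Sum>\<alpha>\<in>exps_below N M. of_nat (chrom_coeff V adj \<alpha>) * (\<Prod>j<N. x j ^ \<alpha> j)) =
    (\<Sum>\<alpha>\<in>exps_below N M. of_nat (card {\<kappa> \<in> colourings N V adj. h \<kappa> = \<alpha>}) * (\<Prod>j<N. x j ^ \<alpha> j))"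
    by (intro sum.cong) (auto simp: coeff)
  also have "\<dots> = (\<Sum>\<kappa>\<in>colourings N V adj. \<Prod>j<N. x j ^ h \<kappa> j)"
    by (intro sum_card_fibres[where w = "\<lambda>\<alpha>. \<Prod>j<N. x j ^ \<alpha> j"] finite_colourings V finite_exps_below range)
  finally show ?thesis by (simp add: weight)
qed

section \<open>Evaluation of products of elementary symmetric functions\<close>

definition esym :: "nat \<Rightarrow> (nat \<Rightarrow> 'c::comm_semiring_1) \<Rightarrow> nat \<Rightarrow> 'c" where
  "esym N x k = (\<Sum>A | A \<subseteq> {..<N} \<and> card A = k. \<Prod>j\<in>A. x j)"

text \<open>The tuples counted by \<open>elem_coeff\<close>, without the condition on
  \<open>\<alpha>\<close> and with all sets confined to the first \<open>N\<close>
  variables.\<close>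

definition subset_lists :: "nat \<Rightarrow> nat list \<Rightarrow> nat set list set" where
  "subset_lists N ps = {Ss. length Ss = length ps \<and>
     (\<forall>i<length ps. Ss ! i \<subseteq> {..<N} \<and> card (Ss ! i) = ps ! i)}"

lemma subset_lists_Cons:
  "subset_lists N (k # ps) =
     (\<lambda>(A, Ss). A # Ss) ` ({A. A \<subseteq> {..<N} \<and> card A = k} \<times> subset_lists N ps)"
proof (intro set_eqI iffI)
  fix Ts assume "Ts \<in> subset_lists N (k # ps)"
  then have T: "length Ts = Suc (length ps)"
    and P: "\<And>i. i < Suc (length ps) \<Longrightarrow> Ts ! i \<subseteq> {..<N} \<and> card (Ts ! i) = (k # ps) ! i"
    by (auto simp: subset_lists_def)
  obtain A Ss where TA: "Ts = A # Ss" using T by (cases Ts) auto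
  have "Ss \<in> subset_lists N ps"
    using T P[of "Suc i" for i] by (auto simp: subset_lists_def TA)
  moreover have "A \<subseteq> {..<N} \<and> card A = k" using P[of 0] TA by auto
  ultimately show "Ts \<in> (\<lambda>(A, Ss). A # Ss) ` ({A. A \<subseteq> {..<N} \<and> card A = k} \<times> subset_lists N ps)"
    using TA by auto
next
  fix Ts assume "Ts \<in> (\<lambda>(A, Ss). A # Ss) ` ({A. A \<subseteq> {..<N} \<and> card A = k} \<times> subset_lists N ps)"
  then obtain A Ss where "A \<subseteq> {..<N}" "card A = k" "Ss \<in> subset_lists N ps" "Ts = A # Ss"
    by (elim imageE) (clarsimp simp: mem_Times_iff)
  then show "Ts \<in> subset_lists N (k # ps)"
    by (simp add: subset_lists_def nth_Cons split: nat.splits)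
qed

lemma finite_subset_lists: "finite (subset_lists N ps)"
proof (induction ps)
  case Nil
  then show ?case by (simp add: subset_lists_def)
next
  case (Cons k ps)
  then show ?case by (simp add: subset_lists_Cons)
qed

lemma sum_subset_lists:
  fixes x :: "nat \<Rightarrow> 'c::comm_semiring_1"
  shows "(\<Sum>Ss\<in>subset_lists N ps. prod_list (map (\<lambda>A. \<Prod>j\<in>A. x j) Ss)) =
         prod_list (map (esym N x) ps)"
proof (induction ps)
  case Nil
  have "subset_lists N [] = {[]}" by (auto simp: subset_lists_def)
  then show ?case by simp
next
  case (Cons k ps)
  let ?A = "{A. A \<subseteq> {..<N} \<and> card A = k}"
  have inj: "inj_on (\<lambda>(A, Ss). A # Ss) (?A \<times> subset_lists N ps)" by (auto simp: inj_on_def)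
  have "(\<Sum>Ss\<in>subset_lists N (k # ps). prod_list (map (\<lambda>A. \<Prod>j\<in>A. x j) Ss)) =
    (\<Sum>(A, Ss)\<in>?A \<times> subset_lists N ps. (\<Prod>j\<in>A. x j) * prod_list (map (\<lambda>A. \<Prod>j\<in>A. x j) Ss))"
    unfolding subset_lists_Cons by (subst sum.reindex[OF inj]) (simp add: case_prod_unfold)
  also have "\<dots> = esym N x k * prod_list (map (esym N x) ps)"
    unfolding Cons.IH[symmetric] esym_def sum_product sum.cartesian_product ..
  finally show ?case by simp
qed

text \<open>A variable lies in at most \<open>length ps\<close> of the sets, so the box of height
  \<open>M\<close> contains all exponents. Grouping the tuples by exponent gives the expanded
  product.\<close>

lemma sum_elem_coeff:
  fixes x :: "nat \<Rightarrow> 'c::comm_semiring_1"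
  assumes M: "length ps \<le> M"
  shows "(\<Sum>\<alpha>\<in>exps_below N M. of_nat (elem_coeff ps \<alpha>) * (\<Prod>j<N. x j ^ \<alpha> j)) =
         prod_list (map (esym N x) ps)"
proof -
  define h :: "nat set list \<Rightarrow> nat \<Rightarrow> nat" where "h Ss j = card {i. i < length ps \<and> j \<in> Ss ! i}" for Ss j
  have fin: "finite {i. i < length ps \<and> Q i}" for Q by simp
  have range: "h ` subset_lists N ps \<subseteq> exps_below N M"
  proof
    fix \<alpha> assume "\<alpha> \<in> h ` subset_lists N ps"
    then obtain Ss where Ss: "Ss \<in> subset_lists N ps" "\<alpha> = h Ss" by auto
    have "h Ss j \<le> M" for j
    proof -
      have "{i. i < length ps \<and> j \<in> Ss ! i} \<subseteq> {..<length ps}" by auto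
      from card_mono[OF _ this] M show ?thesis by (simp add: h_def)
    qed
    moreover have "h Ss j = 0" if "\<not> j < N" for j
    proof -
      have "{i. i < length ps \<and> j \<in> Ss ! i} = {}" using Ss(1) that by (auto simp: subset_lists_def)
      then show ?thesis by (simp only: h_def card.empty)
    qed
    ultimately show "\<alpha> \<in> exps_below N M" using Ss(2) by (auto simp: exps_below_def)
  qed
  have coeff: "elem_coeff ps \<alpha> = card {Ss \<in> subset_lists N ps. h Ss = \<alpha>}"
    if \<alpha>: "\<alpha> \<in> exps_below N M" for \<alpha>
  proof -
    have "Ss ! i \<subseteq> {..<N}" if "\<forall>j. card {i. i < length ps \<and> j \<in> Ss ! i} = \<alpha> j" "i < length ps" for Ss i
    proof
      fix j assume "j \<in> Ss ! i"
      then have "card {i. i < length ps \<and> j \<in> Ss ! i} \<noteq> 0" using that(2) by auto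
      then have "\<alpha> j \<noteq> 0" using that(1) by simp
      then show "j \<in> {..<N}" using exps_below_support[OF \<alpha>] by simp
    qed
    then have "{Ss. length Ss = length ps \<and>
             (\<forall>i<length ps. finite (Ss ! i) \<and> card (Ss ! i) = ps ! i) \<and>
             (\<forall>j. card {i. i < length ps \<and> j \<in> Ss ! i} = \<alpha> j)} = {Ss \<in> subset_lists N ps. h Ss = \<alpha>}"
      by (auto simp: subset_lists_def h_def fun_eq_iff intro: finite_subset)
    then show ?thesis by (simp add: elem_coeff_def)
  qed
  have weight: "(\<Prod>j<N. x j ^ h Ss j) = prod_list (map (\<lambda>A. \<Prod>j\<in>A. x j) Ss)"
    if Ss: "Ss \<in> subset_lists N ps" for Ss
  proof -
    have len: "length Ss = length ps" using Ss by (simp add: subset_lists_def)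
    have "(\<Prod>j<N. x j ^ h Ss j) = (\<Prod>j<N. \<Prod>i<length ps. if j \<in> Ss ! i then x j else 1)"
      by (intro prod.cong) (auto simp: h_def prod.If_cases Int_def)
    also have "\<dots> = (\<Prod>i<length ps. \<Prod>j<N. if j \<in> Ss ! i then x j else 1)" by (rule prod.swap)
    also have "\<dots> = (\<Prod>i<length ps. \<Prod>j\<in>Ss ! i. x j)"
    proof (rule prod.cong[OF refl])
      fix i assume "i \<in> {..<length ps}"
      then have "{..<N} \<inter> Ss ! i = Ss ! i" using Ss by (auto simp: subset_lists_def)
      then show "(\<Prod>j<N. if j \<in> Ss ! i then x j else 1) = (\<Prod>j\<in>Ss ! i. x j)"
        using prod.inter_restrict[of "{..<N}" x "Ss ! i"] by simp
    qed
    also have "\<dots> = prod_list (map (\<lambda>A. \<Prod>j\<in>A. x j) Ss)"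
      by (simp add: prod.list_conv_set_nth len atLeast0LessThan)
    finally show ?thesis .
  qed
  have "(\<Sum>\<alpha>\<in>exps_below N M. of_nat (elem_coeff ps \<alpha>) * (\<Prod>j<N. x j ^ \<alpha> j)) =
    (\<Sum>\<alpha>\<in>exps_below N M. of_nat (card {Ss \<in> subset_lists N ps. h Ss = \<alpha>}) * (\<Prod>j<N. x j ^ \<alpha> j))"
    by (intro sum.cong) (auto simp: coeff)
  also have "\<dots> = (\<Sum>Ss\<in>subset_lists N ps. \<Prod>j<N. x j ^ h Ss j)"
    by (intro sum_card_fibres[where w = "\<lambda>\<alpha>. \<Prod>j<N. x j ^ \<alpha> j"] finite_subset_lists finite_exps_below range)
  finally show ?thesis by (simp add: weight sum_subset_lists)
qed

lemma length_le_sum_list: "0 \<notin> set ps \<Longrightarrow> length ps \<le> sum_list (ps :: nat list)"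
  by (induction ps) auto

text \<open>One family \<open>c\<close> serves all \<open>N\<close> and \<open>x\<close>. This
  uniformity later allows coefficients to be compared while the evaluation point moves.\<close>

lemma e_positive_specialise:
  assumes "e_positive V adj" and V: "finite V"
  shows "\<exists>c :: nat list \<Rightarrow> real. (\<forall>ps\<in>partitions_of (card V). 0 \<le> c ps) \<and>
    (\<forall>N (x :: nat \<Rightarrow> complex). (\<Sum>\<kappa>\<in>colourings N V adj. \<Prod>v\<in>V. x (\<kappa> v)) =
       (\<Sum>ps\<in>partitions_of (card V). of_real (c ps) * prod_list (map (esym N x) ps)))"
proof -
  obtain c where c: "\<And>ps. ps \<in> partitions_of (card V) \<Longrightarrow> 0 \<le> c ps"
    and eq: "\<And>\<alpha>. \<alpha> \<in> monomial_exps \<Longrightarrow> real (chrom_coeff V adj \<alpha>) =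
           (\<Sum>ps\<in>partitions_of (card V). c ps * real (elem_coeff ps \<alpha>))"
    using assms unfolding e_positive_def by blast
  have "(\<Sum>\<kappa>\<in>colourings N V adj. \<Prod>v\<in>V. x (\<kappa> v)) =
       (\<Sum>ps\<in>partitions_of (card V). of_real (c ps) * prod_list (map (esym N x) ps))"
    for N and x :: "nat \<Rightarrow> complex"
  proof -
    let ?w = "\<lambda>\<alpha>. \<Prod>j<N. x j ^ \<alpha> j" and ?T = "exps_below N (card V)"
    have eq': "(of_nat (chrom_coeff V adj \<alpha>) :: complex) =
           (\<Sum>ps\<in>partitions_of (card V). of_real (c ps) * of_nat (elem_coeff ps \<alpha>))" if "\<alpha> \<in> ?T" for \<alpha>
      using arg_cong[OF eq, of \<alpha> complex_of_real] that exps_below_subset by auto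
    have "(\<Sum>\<kappa>\<in>colourings N V adj. \<Prod>v\<in>V. x (\<kappa> v)) =
      (\<Sum>\<alpha>\<in>?T. of_nat (chrom_coeff V adj \<alpha>) * ?w \<alpha>)"
      using V by (simp add: sum_chrom_coeff)
    also have "\<dots> = (\<Sum>\<alpha>\<in>?T. \<Sum>ps\<in>partitions_of (card V). of_real (c ps) * (of_nat (elem_coeff ps \<alpha>) * ?w \<alpha>))"
      by (intro sum.cong refl) (simp add: eq' sum_distrib_right mult.assoc)
    also have "\<dots> = (\<Sum>ps\<in>partitions_of (card V). \<Sum>\<alpha>\<in>?T. of_real (c ps) * (of_nat (elem_coeff ps \<alpha>) * ?w \<alpha>))"
      by (rule sum.swap)
    also have "\<dots> = (\<Sum>ps\<in>partitions_of (card V). of_real (c ps) * (\<Sum>\<alpha>\<in>?T. of_nat (elem_coeff ps \<alpha>) * ?w \<alpha>))"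
      by (simp add: sum_distrib_left)
    also have "\<dots> = (\<Sum>ps\<in>partitions_of (card V). of_real (c ps) * prod_list (map (esym N x) ps))"
    proof (intro sum.cong refl)
      fix ps assume "ps \<in> partitions_of (card V)"
      then have "length ps \<le> card V" using length_le_sum_list[of ps] by (simp add: partitions_of_def)
      then show "of_real (c ps) * (\<Sum>\<alpha>\<in>?T. of_nat (elem_coeff ps \<alpha>) * ?w \<alpha>) =
          of_real (c ps) * prod_list (map (esym N x) ps)"
        by (simp add: sum_elem_coeff)
    qed
    finally show ?thesis .
  qed
  with c show ?thesis by blast
qed

subsection \<open>Colourings of spiders\<close>

text \<open>A colouring after attaching a leaf \<open>w\<close> to \<open>u\<close> is a colouring
  before it, together with a colour for \<open>w\<close> different from that of
  \<open>u\<close>.\<close>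

lemma sum_colourings_leaf:
  fixes G :: "('v \<Rightarrow> nat) \<Rightarrow> 'c::comm_monoid_add"
  assumes V: "finite V" "u \<in> V" "w \<notin> V"
    and adj: "\<forall>v\<in>V. \<forall>v'\<in>V. adj' v v' \<longleftrightarrow> adj v v'"
      "\<forall>v\<in>V. adj' w v \<longleftrightarrow> v = u" "\<forall>v\<in>V. adj' v w \<longleftrightarrow> v = u" "\<not> adj' w w"
  shows "(\<Sum>\<kappa>\<in>colourings N (insert w V) adj'. G \<kappa>) =
         (\<Sum>\<kappa>\<in>colourings N V adj. \<Sum>i\<in>{..<N} - {\<kappa> u}. G (\<kappa>(w := i)))"
proof -
  let ?S = "SIGMA \<kappa>:colourings N V adj. {..<N} - {\<kappa> u}"
  have "bij_betw (\<lambda>(\<kappa>, i). \<kappa>(w := i)) ?S (colourings N (insert w V) adj')"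
  \<comment> \<open>Colourings are extensional, so removing \<open>w\<close> means resetting its
    value to \<open>undefined\<close>.\<close>
  proof (rule bij_betw_byWitness[where f' = "\<lambda>\<kappa>. (\<kappa>(w := undefined), \<kappa> w)"])
    show "\<forall>a\<in>?S. (\<lambda>\<kappa>. (\<kappa>(w := undefined), \<kappa> w)) ((\<lambda>(\<kappa>, i). \<kappa>(w := i)) a) = a"
    proof clarsimp
      fix \<kappa> i assume "\<kappa> \<in> colourings N V adj"
      then show "\<kappa>(w := undefined) = \<kappa>"
        using V(3) by (auto simp: colourings_def PiE_def extensional_def)
    qed
    show "\<forall>a'\<in>colourings N (insert w V) adj'. (\<lambda>(\<kappa>, i). \<kappa>(w := i)) (a'(w := undefined), a' w) = a'"
      by simp
    show "(\<lambda>(\<kappa>, i). \<kappa>(w := i)) ` ?S \<subseteq> colourings N (insert w V) adj'"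
    proof (rule image_subsetI)
      fix z assume "z \<in> ?S"
      then obtain \<kappa> i where z: "z = (\<kappa>, i)" and \<kappa>: "\<kappa> \<in> colourings N V adj"
        and i: "i < N" "i \<noteq> \<kappa> u"
        by auto
      have "\<kappa>(w := i) \<in> insert w V \<rightarrow>\<^sub>E {..<N}"
        using \<kappa> i by (intro PiE_fun_upd) (simp_all add: colourings_def)
      moreover have "(\<kappa>(w := i)) v \<noteq> (\<kappa>(w := i)) v'"
        if "v \<in> insert w V" "v' \<in> insert w V" "adj' v v'" for v v'
      proof (cases "v = w"; cases "v' = w")
        assume "v \<noteq> w" "v' \<noteq> w"
        then show ?thesis using \<kappa> that adj(1) by (auto simp: colourings_def)
      qed (use that adj(2-4) i V in auto)
      ultimately show "(\<lambda>(\<kappa>, i). \<kappa>(w := i)) z \<in> colourings N (insert w V) adj'"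
        unfolding z colourings_def prod.case mem_Collect_eq by blast
    qed
    show "(\<lambda>\<kappa>. (\<kappa>(w := undefined), \<kappa> w)) ` colourings N (insert w V) adj' \<subseteq> ?S"
    proof (rule image_subsetI)
      fix \<kappa> assume \<kappa>: "\<kappa> \<in> colourings N (insert w V) adj'"
      then have P: "\<kappa> \<in> insert w V \<rightarrow>\<^sub>E {..<N}"
        and ne: "\<And>v v'. v \<in> insert w V \<Longrightarrow> v' \<in> insert w V \<Longrightarrow> adj' v v' \<Longrightarrow> \<kappa> v \<noteq> \<kappa> v'"
        by (auto simp: colourings_def)
      have "\<kappa>(w := undefined) \<in> V \<rightarrow>\<^sub>E {..<N}"
        using V(3) P by (rule fun_upd_in_PiE)
      moreover have "(\<kappa>(w := undefined)) v \<noteq> (\<kappa>(w := undefined)) v'"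
        if "v \<in> V" "v' \<in> V" "adj v v'" for v v'
      proof -
        have "v \<noteq> w" "v' \<noteq> w" using that V by auto
        then show ?thesis using ne[of v v'] that adj(1) by auto
      qed
      moreover have "\<kappa> w < N" using P by auto
      moreover have "\<kappa> w \<noteq> \<kappa> u" using ne[of w u] V adj(2) by auto
      moreover have "u \<noteq> w" using V by auto
      ultimately show "(\<kappa>(w := undefined), \<kappa> w) \<in> ?S"
        unfolding colourings_def by auto
    qed
  qed
  from sum.reindex_bij_betw[OF this, of G]
  have "(\<Sum>\<kappa>\<in>colourings N (insert w V) adj'. G \<kappa>) = (\<Sum>(\<kappa>, i)\<in>?S. G (\<kappa>(w := i)))"
    by (simp add: case_prod_unfold)
  also have "\<dots> = (\<Sum>\<kappa>\<in>colourings N V adj. \<Sum>i\<in>{..<N} - {\<kappa> u}. G (\<kappa>(w := i)))"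
    by (rule sum.Sigma[symmetric]) (auto intro: finite_colourings V)
  finally show ?thesis .
qed

text \<open>Weighted count of the colourings of a path of \<open>m\<close> vertices hanging off a vertex of colour \<open>i\<close>.\<close>

fun walk :: "nat \<Rightarrow> (nat \<Rightarrow> 'c::comm_ring_1) \<Rightarrow> nat \<Rightarrow> nat \<Rightarrow> 'c" where
  "walk N x 0 i = 1"
| "walk N x (Suc m) i = (\<Sum>j\<in>{..<N} - {i}. x j * walk N x m j)"

text \<open>An empty leg ends at the centre, whatever \<open>k\<close> is.\<close>

definition leg_end :: "nat \<Rightarrow> nat \<Rightarrow> nat \<times> nat" where
  "leg_end k l = (if l = 0 then (0, 0) else (k, l))"

lemma finite_spider_verts: "finite (spider_verts a b c)"
  by (rule finite_subset[of _ "{..3} \<times> {..a + b + c}"]) (auto simp: spider_verts_def)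

lemma leg_end_in_verts:
  "leg_end 1 a \<in> spider_verts a b c" "leg_end 2 b \<in> spider_verts a b c"
  "leg_end 3 c \<in> spider_verts a b c"
  by (auto simp: leg_end_def spider_verts_def)

text \<open>Colouring sum of a spider in which each leg carries a pending path of further vertices
at its end, summed out already.\<close>

definition spider_sum :: "nat \<Rightarrow> (nat \<Rightarrow> 'c::comm_ring_1) \<Rightarrow> nat \<Rightarrow> nat \<Rightarrow> nat \<Rightarrow> nat \<Rightarrow> nat \<Rightarrow> nat \<Rightarrow> 'c" where
  "spider_sum N x a b c p q r =
     (\<Sum>\<kappa>\<in>colourings N (spider_verts a b c) (spider_adj a b c).
        (\<Prod>v\<in>spider_verts a b c. x (\<kappa> v)) *
        (walk N x p (\<kappa> (leg_end 1 a)) * walk N x q (\<kappa> (leg_end 2 b)) * walk N x r (\<kappa> (leg_end 3 c))))"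

text \<open>Summing out the colour of the leaf \<open>w\<close> moves it from the graph into the
  pending path at \<open>u\<close>. The vertices \<open>s\<close> and \<open>t\<close> stand for the
  ends of the two other legs, which are unaffected.\<close>

lemma sum_leaf_weight:
  fixes x :: "nat \<Rightarrow> 'c::comm_ring_1"
  assumes V: "finite V" "u \<in> V" "w \<notin> V"
    and adj: "\<forall>v\<in>V. \<forall>v'\<in>V. adj' v v' \<longleftrightarrow> adj v v'"
      "\<forall>v\<in>V. adj' w v \<longleftrightarrow> v = u" "\<forall>v\<in>V. adj' v w \<longleftrightarrow> v = u" "\<not> adj' w w"
    and st: "s \<in> V" "t \<in> V"
  shows "(\<Sum>\<kappa>\<in>colourings N (insert w V) adj'. (\<Prod>v\<in>insert w V. x (\<kappa> v)) *
           (walk N x p (\<kappa> w) * h (\<kappa> s) (\<kappa> t))) =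
         (\<Sum>\<kappa>\<in>colourings N V adj. (\<Prod>v\<in>V. x (\<kappa> v)) * (walk N x (Suc p) (\<kappa> u) * h (\<kappa> s) (\<kappa> t)))"
proof -
  have [simp]: "s \<noteq> w" "t \<noteq> w" using st V by auto
  have pr: "(\<Prod>v\<in>V. x ((\<kappa>(w := i)) v)) = (\<Prod>v\<in>V. x (\<kappa> v))" for \<kappa> i
    using V by (intro prod.cong) auto
  let ?G = "\<lambda>\<kappa>. (\<Prod>v\<in>insert w V. x (\<kappa> v)) * (walk N x p (\<kappa> w) * h (\<kappa> s) (\<kappa> t))"
  have "(\<Sum>\<kappa>\<in>colourings N (insert w V) adj'. ?G \<kappa>) =
      (\<Sum>\<kappa>\<in>colourings N V adj. \<Sum>i\<in>{..<N} - {\<kappa> u}. ?G (\<kappa>(w := i)))"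
    by (rule sum_colourings_leaf[OF V adj])
  also have "\<dots> =
      (\<Sum>\<kappa>\<in>colourings N V adj. (\<Prod>v\<in>V. x (\<kappa> v)) * (walk N x (Suc p) (\<kappa> u) * h (\<kappa> s) (\<kappa> t)))"
  proof (rule sum.cong[OF refl])
    fix \<kappa>
    have "(\<Prod>v\<in>insert w V. x ((\<kappa>(w := i)) v)) = x i * (\<Prod>v\<in>V. x (\<kappa> v))" for i
      unfolding prod.insert[OF V(1,3)] pr by simp
    then show "(\<Sum>i\<in>{..<N} - {\<kappa> u}. ?G (\<kappa>(w := i))) =
        (\<Prod>v\<in>V. x (\<kappa> v)) * (walk N x (Suc p) (\<kappa> u) * h (\<kappa> s) (\<kappa> t))"
      by (simp add: sum_distrib_left sum_distrib_right mult_ac)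
  qed
  finally show ?thesis .
qed

lemma spider_verts_Suc:
  "spider_verts (Suc a) b c = insert (1, Suc a) (spider_verts a b c)"
  "spider_verts a (Suc b) c = insert (2, Suc b) (spider_verts a b c)"
  "spider_verts a b (Suc c) = insert (3, Suc c) (spider_verts a b c)"
  by (auto simp: spider_verts_def)

lemma leg_end_Suc: "leg_end k (Suc l) = (k, Suc l)"
  by (simp add: leg_end_def)

lemma mem_spider_verts:
  "(k, j) \<in> spider_verts a b c \<longleftrightarrow>
     k = 0 \<and> j = 0 \<or> 1 \<le> j \<and> (k = 1 \<and> j \<le> a \<or> k = 2 \<and> j \<le> b \<or> k = 3 \<and> j \<le> c)"
  by (auto simp: spider_verts_def)

lemma spider_edge_simps:
  "spider_edge (k, j) (k', j') \<longleftrightarrow> k \<noteq> 0 \<and> k' = k \<and> j' = j + 1 \<or> k = 0 \<and> j = 0 \<and> k' \<noteq> 0 \<and> j' = 1"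
  by (simp add: spider_edge_def)

lemma spider_adj_Suc:
  "\<forall>v\<in>spider_verts a b c. spider_adj (Suc a) b c (1, Suc a) v \<longleftrightarrow> v = leg_end 1 a"
  "\<forall>v\<in>spider_verts a b c. spider_adj a (Suc b) c (2, Suc b) v \<longleftrightarrow> v = leg_end 2 b"
  "\<forall>v\<in>spider_verts a b c. spider_adj a b (Suc c) (3, Suc c) v \<longleftrightarrow> v = leg_end 3 c"
  unfolding spider_adj_def split_paired_All Ball_def
    mem_spider_verts spider_edge_simps leg_end_def
  by (simp_all split: if_splits) presburger+

lemma spider_adj_commute: "spider_adj a b c u v \<longleftrightarrow> spider_adj a b c v u"
  by (auto simp: spider_adj_def)

lemmas spider_adj_Suc' = spider_adj_Suc[unfolded spider_adj_commute[of _ _ _ "(_, _)"]]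

lemma spider_adj_mono:
  "\<forall>u\<in>spider_verts a b c. \<forall>v\<in>spider_verts a b c. spider_adj (Suc a) b c u v \<longleftrightarrow> spider_adj a b c u v"
  "\<forall>u\<in>spider_verts a b c. \<forall>v\<in>spider_verts a b c. spider_adj a (Suc b) c u v \<longleftrightarrow> spider_adj a b c u v"
  "\<forall>u\<in>spider_verts a b c. \<forall>v\<in>spider_verts a b c. spider_adj a b (Suc c) u v \<longleftrightarrow> spider_adj a b c u v"
  by (simp_all add: spider_adj_def spider_verts_Suc)

lemma spider_adj_irrefl: "\<not> spider_adj a b c v v"
  by (auto simp: spider_adj_def spider_edge_def)

lemma new_end_notin_verts:
  "(1, Suc a) \<notin> spider_verts a b c" "(2, Suc b) \<notin> spider_verts a b c"
  "(3, Suc c) \<notin> spider_verts a b c"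
  by (auto simp: spider_verts_def)

lemma spider_sum_Suc1: "spider_sum N x (Suc a) b c p q r = spider_sum N x a b c (Suc p) q r"
  using sum_leaf_weight[where V = "spider_verts a b c" and adj = "spider_adj a b c"
      and adj' = "spider_adj (Suc a) b c" and x = x and N = N and p = p and h = "\<lambda>i j. walk N x q i * walk N x r j",
      OF finite_spider_verts leg_end_in_verts(1) new_end_notin_verts(1)
      spider_adj_mono(1) spider_adj_Suc(1) spider_adj_Suc'(1) spider_adj_irrefl leg_end_in_verts(2,3)]
  unfolding spider_sum_def spider_verts_Suc leg_end_Suc by (simp only: mult_ac)

lemma spider_sum_Suc2: "spider_sum N x a (Suc b) c p q r = spider_sum N x a b c p (Suc q) r"
  using sum_leaf_weight[where V = "spider_verts a b c" and adj = "spider_adj a b c"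
      and adj' = "spider_adj a (Suc b) c" and x = x and N = N and p = q and h = "\<lambda>i j. walk N x p i * walk N x r j",
      OF finite_spider_verts leg_end_in_verts(2) new_end_notin_verts(2)
      spider_adj_mono(2) spider_adj_Suc(2) spider_adj_Suc'(2) spider_adj_irrefl leg_end_in_verts(1,3)]
  unfolding spider_sum_def spider_verts_Suc leg_end_Suc by (simp only: mult_ac)

lemma spider_sum_Suc3: "spider_sum N x a b (Suc c) p q r = spider_sum N x a b c p q (Suc r)"
  using sum_leaf_weight[where V = "spider_verts a b c" and adj = "spider_adj a b c"
      and adj' = "spider_adj a b (Suc c)" and x = x and N = N and p = r and h = "\<lambda>i j. walk N x p i * walk N x q j",
      OF finite_spider_verts leg_end_in_verts(3) new_end_notin_verts(3)
      spider_adj_mono(3) spider_adj_Suc(3) spider_adj_Suc'(3) spider_adj_irrefl leg_end_in_verts(1,2)]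
  unfolding spider_sum_def spider_verts_Suc leg_end_Suc by (simp only: mult_ac)

lemma spider_sum_0:
  "spider_sum N x 0 0 0 p q r = (\<Sum>i<N. x i * (walk N x p i * walk N x q i * walk N x r i))"
proof -
  have V: "spider_verts 0 0 0 = {(0, 0)}" by (auto simp: spider_verts_def)
  have bij: "bij_betw (\<lambda>i. \<lambda>v\<in>{(0, 0)}. i) {..<N}
      (colourings N (spider_verts 0 0 0) (spider_adj 0 0 0))"
    by (rule bij_betw_byWitness[where f' = "\<lambda>\<kappa>. \<kappa> (0, 0)"])
       (auto simp: V colourings_def spider_adj_def spider_edge_def PiE_def extensional_def fun_eq_iff)
  show ?thesis
    unfolding spider_sum_def sum.reindex_bij_betw[OF bij, symmetric]
    by (simp add: V leg_end_def)
qed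

text \<open>Induction on the number of leg vertices: each one is moved into the pending path of its
  leg until only the centre is left.\<close>

lemma spider_sum_reduce: "spider_sum N x a b c p q r = spider_sum N x 0 0 0 (a + p) (b + q) (c + r)"
proof (induction "a + b + c" arbitrary: a b c p q r)
  case (Suc n)
  then consider a' where "a = Suc a'" | b' where "b = Suc b'" | c' where "c = Suc c'"
    by (metis add_is_0 nat.distinct(1) not0_implies_Suc)
  then show ?case
    by cases (use Suc.hyps in \<open>auto simp: spider_sum_Suc1 spider_sum_Suc2 spider_sum_Suc3\<close>)
qed auto

lemma spider_colouring_sum:
  "(\<Sum>\<kappa>\<in>colourings N (spider_verts a b c) (spider_adj a b c). \<Prod>v\<in>spider_verts a b c. x (\<kappa> v)) =
     (\<Sum>i<N. x i * (walk N x a i * walk N x b i * walk N x c i))"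
  using spider_sum_reduce[of N x a b c 0 0 0] unfolding spider_sum_0 by (simp add: spider_sum_def)

subsection \<open>Generating function of paths\<close>

text \<open>Roots are split off one at a time. Constant term 1 makes each root \<open>r\<close>
  nonzero, so its factor can be normalised to \<open>[:1, - 1 / r:]\<close>; a degree below
  \<open>N\<close> is padded with \<open>x i = 0\<close>.\<close>

lemma exists_prod_linear_factors:
  fixes E :: "'c::alg_closed_field poly"
  assumes "coeff E 0 = 1" "degree E \<le> N"
  shows "\<exists>x. E = (\<Prod>i<N. [:1, x i:])"
  using assms
proof (induction N arbitrary: E)
  case 0
  then show ?case by (auto elim!: degree_eq_zeroE)
next
  case (Suc N)
  show ?case
  proof (cases "degree E = 0")
    case True
    then have "E = (\<Prod>i<Suc N. [:1, 0:])"
      using Suc.prems by (auto elim!: degree_eq_zeroE simp flip: one_pCons)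
    then show ?thesis by (intro exI[of _ "\<lambda>_. 0"])
  next
    case False
    then obtain r where r: "poly E r = 0" using alg_closed_imp_poly_has_root[of E] by auto
    then obtain Q where Q: "E = [:-r, 1:] * Q" by (auto simp: poly_eq_0_iff_dvd elim: dvdE)
    have "- r * coeff Q 0 = 1" using Suc.prems(1) by (simp add: Q)
    then have "r \<noteq> 0" by auto
    have "Q \<noteq> 0" using False Q by auto
    then have "degree E = Suc (degree Q)" by (simp add: Q degree_mult_eq del: mult_pCons_left)
    then have "\<exists>x. smult (- r) Q = (\<Prod>i<N. [:1, x i:])"
      using Suc.prems \<open>- r * coeff Q 0 = 1\<close> by (intro Suc.IH) auto
    then obtain x where x: "smult (- r) Q = (\<Prod>i<N. [:1, x i:])" ..
    have "E = [:1, - 1 / r:] * smult (- r) Q"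
      using \<open>r \<noteq> 0\<close> by (simp add: Q smult_add_right)
    also have "\<dots> = (\<Prod>i<Suc N. [:1, (x(N := - 1 / r)) i:])"
      unfolding x by (simp add: mult.commute)
    finally show ?thesis by (intro exI[of _ "x(N := - 1 / r)"])
  qed
qed

text \<open>Vieta: expand the product over subsets. Prescribing the polynomial thus prescribes all
  elementary symmetric functions of the \<open>x i\<close>.\<close>

lemma coeff_prod_linear_factors:
  fixes x :: "nat \<Rightarrow> 'c::comm_ring_1"
  shows "coeff (\<Prod>i<N. [:1, x i:]) k = esym N x k"
proof -
  have "(\<Prod>i<N. [:1, x i:]) = (\<Prod>i<N. [:0, x i:] + 1)"
    by (simp add: one_pCons)
  also have "\<dots> = (\<Sum>A\<in>Pow {..<N}. \<Prod>i\<in>A. [:0, x i:])"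
    by (simp add: prod_add)
  also have "\<dots> = (\<Sum>A\<in>Pow {..<N}. monom (\<Prod>i\<in>A. x i) (card A))"
  proof (rule sum.cong[OF refl])
    fix A assume "A \<in> Pow {..<N}"
    then have "finite A" by (auto intro: finite_subset)
    then show "(\<Prod>i\<in>A. [:0, x i:]) = monom (\<Prod>i\<in>A. x i) (card A)"
      by (induction A rule: finite_induct) (auto simp: monom_Suc smult_monom)
  qed
  finally have "coeff (\<Prod>i<N. [:1, x i:]) k = (\<Sum>A\<in>Pow {..<N}. if card A = k then \<Prod>i\<in>A. x i else 0)"
    by (simp add: coeff_sum)
  also have "\<dots> = esym N x k"
    unfolding esym_def by (subst sum.inter_filter[symmetric]) auto
  finally show ?thesis .
qed

text \<open>The chromatic symmetric function of the path on \<open>n\<close> vertices, evaluated at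
  \<open>x\<close>; the empty path counts 1.\<close>

definition path_sum :: "nat \<Rightarrow> (nat \<Rightarrow> 'c::comm_ring_1) \<Rightarrow> nat \<Rightarrow> 'c" where
  "path_sum N x n = (case n of 0 \<Rightarrow> 1 | Suc m \<Rightarrow> \<Sum>i<N. x i * walk N x m i)"

text \<open>Sum over all colours of the first vertex, then subtract the forbidden colour
  \<open>i\<close>.\<close>

lemma walk_Suc: "i < N \<Longrightarrow> walk N x (Suc m) i = path_sum N x (Suc m) - x i * walk N x m i"
  by (simp add: path_sum_def sum_diff1)

text \<open>With \<open>W i\<close> the generating function of walks from colour \<open>i\<close>,
  \<open>walk_Suc\<close> reads \<open>(1 + x i * z) * W i = P\<close>, while
  \<open>P = 1 + z * (\<Sum>i<N. x i * W i)\<close>. Multiplying the latter by \<open>E\<close>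
  gives \<open>E * P = E + z * E' * P\<close>.\<close>

lemma path_sum_gf:
  fixes x :: "nat \<Rightarrow> 'c::idom" and N :: nat
  defines "E \<equiv> \<Prod>i<N. [:1, x i:]"
  shows "Abs_fps (path_sum N x) * fps_of_poly (E - pCons 0 (pderiv E)) = fps_of_poly E"
proof -
  let ?P = "Abs_fps (path_sum N x)"
  define W where "W i = Abs_fps (\<lambda>m. walk N x m i)" for i
  define L where "L i = fps_of_poly [:1, x i:]" for i
  have L: "L i = 1 + fps_const (x i) * fps_X" for i
    by (simp add: L_def fps_of_poly_pCons mult.commute)
  have W: "L i * W i = ?P" if "i < N" for i
  proof (rule fps_ext)
    fix n
    show "fps_nth (L i * W i) n = fps_nth ?P n"
    proof (cases n)
      case 0
      then show ?thesis by (simp add: L W_def path_sum_def)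
    next
      case (Suc m)
      then show ?thesis
        using walk_Suc[OF that, of x m] by (simp add: L W_def distrib_right mult.assoc del: walk.simps(2))
    qed
  qed
  have P: "?P = 1 + fps_X * (\<Sum>i<N. fps_const (x i) * W i)"
  proof (rule fps_ext)
    fix n
    show "fps_nth ?P n = fps_nth (1 + fps_X * (\<Sum>i<N. fps_const (x i) * W i)) n"
      by (cases n) (simp_all add: path_sum_def W_def fps_sum_nth)
  qed
  have E: "fps_of_poly E = (\<Prod>i<N. L i)"
    by (simp add: E_def L_def fps_of_poly_prod)
  have E': "fps_of_poly (pderiv E) = (\<Sum>i<N. (\<Prod>j\<in>{..<N} - {i}. L j) * fps_const (x i))"
    by (simp add: E_def L_def pderiv_prod fps_of_poly_sum fps_of_poly_mult fps_of_poly_prod pderiv_pCons fps_of_poly_const fps_of_poly_smult mult.commute)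
  have *: "(\<Prod>i<N. L i) * W i = (\<Prod>j\<in>{..<N} - {i}. L j) * ?P" if "i < N" for i
    using W[OF that] that by (subst prod.remove[of _ i]) (auto simp: mult_ac)
  have "fps_of_poly E * ?P = fps_of_poly E + fps_X * (\<Sum>i<N. fps_const (x i) * (fps_of_poly E * W i))"
    by (subst P) (simp add: algebra_simps sum_distrib_left)
  also have "(\<Sum>i<N. fps_const (x i) * (fps_of_poly E * W i)) = fps_of_poly (pderiv E) * ?P"
    unfolding E E' sum_distrib_right
  proof (rule sum.cong[OF refl])
    fix i assume "i \<in> {..<N}"
    then have "fps_const (x i) * ((\<Prod>i<N. L i) * W i) =
        fps_const (x i) * ((\<Prod>j\<in>{..<N} - {i}. L j) * ?P)"
      using *[of i] by simp
    then show "fps_const (x i) * ((\<Prod>i<N. L i) * W i) =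
        (\<Prod>j\<in>{..<N} - {i}. L j) * fps_const (x i) * ?P"
      by (simp only: mult_ac)
  qed
  finally show ?thesis
    by (simp add: fps_of_poly_diff fps_of_poly_pCons algebra_simps)
qed

text \<open>Both sides count colourings of a path, the left one by the colour \<open>i\<close> of an
  inner vertex with arms of \<open>a\<close> and \<open>b\<close> vertices. The induction moves one
  vertex across: by \<open>walk_Suc\<close> both sums have the same correction term.\<close>

lemma sum_walk_walk:
  "(\<Sum>i<N. x i * (walk N x a i * walk N x b i)) = path_sum N x (Suc (a + b))"
proof (induction a arbitrary: b)
  case 0
  show ?case by (simp add: path_sum_def)
next
  case (Suc a)
  have "(\<Sum>i<N. x i * (walk N x (Suc a) i * walk N x b i)) =
      (\<Sum>i<N. x i * walk N x b i) * path_sum N x (Suc a) - (\<Sum>i<N. x i * (x i * walk N x a i * walk N x b i))"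
    by (simp add: walk_Suc algebra_simps sum_subtractf sum_distrib_left del: walk.simps(2))
  also have "\<dots> = (\<Sum>i<N. x i * walk N x a i) * path_sum N x (Suc b) - (\<Sum>i<N. x i * (x i * walk N x a i * walk N x b i))"
    by (simp add: path_sum_def mult.commute)
  also have "\<dots> = (\<Sum>i<N. x i * (walk N x a i * walk N x (Suc b) i))"
    by (simp add: walk_Suc algebra_simps sum_subtractf sum_distrib_left del: walk.simps(2))
  also have "\<dots> = path_sum N x (Suc (a + Suc b))" by (rule Suc.IH)
  finally show ?case by simp
qed

text \<open>The hypotheses make the short leg contribute \<open>x i * x i\<close>. One factor
  \<open>x i\<close> goes to each long leg, where \<open>walk_Suc\<close> trades it for a longer
  walk; expanding leaves sums over paths only.\<close>

lemma spider_sum_path_sums: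
  assumes 1: "path_sum N x 1 = 0" and 2: "path_sum N x 2 = 0"
  shows "(\<Sum>i<N. x i * (walk N x a i * walk N x b i * walk N x 2 i)) =
    path_sum N x (a + b + 3) - path_sum N x (a + 1) * path_sum N x (b + 2)
      - path_sum N x (a + 2) * path_sum N x (b + 1)"
proof -
  have w2: "walk N x 2 i = x i * x i" if "i < N" for i
    using walk_Suc[OF that, of x 0] walk_Suc[OF that, of x 1] 1 2 by (simp add: numeral_2_eq_2 del: walk.simps(2))
  have xw: "x i * walk N x m i = path_sum N x (Suc m) - walk N x (Suc m) i" if "i < N" for i m
    using walk_Suc[OF that, of x m] by (simp del: walk.simps(2))
  have s: "(\<Sum>i<N. x i * walk N x m i) = path_sum N x (Suc m)" for m
    by (simp add: path_sum_def)
  have x: "(\<Sum>i<N. x i) = 0" using 1 by (simp add: path_sum_def)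
  have "(\<Sum>i<N. x i * (walk N x a i * walk N x b i * walk N x 2 i)) =
    (\<Sum>i<N. x i * ((x i * walk N x a i) * (x i * walk N x b i)))"
    by (intro sum.cong refl) (simp add: w2 mult_ac)
  also have "\<dots> = (\<Sum>i<N. x i * ((path_sum N x (Suc a) - walk N x (Suc a) i) * (path_sum N x (Suc b) - walk N x (Suc b) i)))"
    by (intro sum.cong refl) (simp add: xw del: walk.simps(2))
  also have "\<dots> = (\<Sum>i<N. x i) * path_sum N x (Suc a) * path_sum N x (Suc b)
      - path_sum N x (Suc a) * (\<Sum>i<N. x i * walk N x (Suc b) i)
      - (\<Sum>i<N. x i * walk N x (Suc a) i) * path_sum N x (Suc b)
      + (\<Sum>i<N. x i * (walk N x (Suc a) i * walk N x (Suc b) i))"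
    by (simp add: algebra_simps sum_subtractf sum.distrib sum_distrib_left sum_distrib_right del: walk.simps(2))
  finally show ?thesis
    unfolding s x sum_walk_walk by (simp add: eval_nat_numeral)
qed

subsection \<open>Specialisation to two elementary symmetric functions\<close>

text \<open>Specialisation of the path on \<open>n\<close> vertices to \<open>e\<^sub>3 = 1\<close>, \<open>e\<^sub>p = v\<close> and all other
\<open>e\<^sub>k = 0\<close>, as a polynomial in \<open>v\<close>.\<close>

fun path_poly :: "nat \<Rightarrow> nat \<Rightarrow> real poly" where
  "path_poly p n =
     (if n = 0 then 1
      else (if n < 3 then 0 else smult 2 (path_poly p (n - 3))) +
           (if p = 0 \<or> n < p then 0 else pCons 0 (smult (real p - 1) (path_poly p (n - p)))) +
           (if n = 3 then 1 else 0) + (if n = p then [:0, 1:] else 0))"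

declare path_poly.simps [simp del]

text \<open>As many variables as the largest possible degree \<open>p\<close>; for
  \<open>v = 0\<close> the degree drops to 3, which the factorisation permits.\<close>

lemma specialisation_exists:
  assumes "4 \<le> p"
  obtains x :: "nat \<Rightarrow> complex" where "(\<Prod>i<p. [:1, x i:]) = 1 + monom 1 3 + monom (of_real v) p"
proof -
  let ?E = "1 + monom 1 3 + monom (of_real v) p :: complex poly"
  have "coeff ?E 0 = 1" using assms by simp
  moreover have "degree ?E \<le> p"
    using assms by (intro degree_add_le) (auto intro: order.trans[OF degree_monom_le])
  ultimately show thesis using exists_prod_linear_factors[of ?E p] that by metis
qed

text \<open>Here \<open>E - z * E' = 1 - 2 * z^3 - (p - 1) * v * z^p\<close>, so comparing
  coefficients in \<open>path_sum_gf\<close> yields the recurrence of \<open>path_poly\<close>, with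
  the numerator \<open>E\<close> supplying the extra terms at lengths 0, 3 and
  \<open>p\<close>.\<close>

lemma path_sum_eq_path_poly:
  assumes p: "4 \<le> p"
    and E: "(\<Prod>i<p. [:1, x i:]) = 1 + monom 1 3 + monom (of_real v) p"
  shows "path_sum p x n = (of_real (poly (path_poly p n) v) :: complex)"
proof -
  define P where "P = Abs_fps (path_sum p x)"
  let ?E = "1 + monom 1 3 + monom (of_real v) p :: complex poly"
  have poly_E: "fps_of_poly ?E = 1 + fps_X ^ 3 + fps_const (of_real v) * fps_X ^ p"
    by (simp add: fps_of_poly_add fps_of_poly_monom)
  have "?E - pCons 0 (pderiv ?E) = 1 - monom 2 3 - monom (of_nat (p - 1) * of_real v) p"
  proof -
    have "pCons 0 (pderiv ?E) = monom 3 3 + monom (of_nat p * of_real v) p"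
      using p by (auto simp: pderiv_add pderiv_monom poly_eq_iff coeff_pCons split: nat.splits)
    moreover have "of_nat p = (of_nat (p - 1) + 1 :: complex)" using p by (simp add: of_nat_diff)
    ultimately show ?thesis
      by (simp only:) (simp add: poly_eq_iff algebra_simps)
  qed
  then have poly_D: "fps_of_poly (?E - pCons 0 (pderiv ?E)) =
      1 - fps_const 2 * fps_X ^ 3 - fps_const (of_nat (p - 1) * of_real v) * fps_X ^ p"
    by (simp only: fps_of_poly_diff fps_of_poly_1 fps_of_poly_monom)
  have gf: "P * (1 - fps_const 2 * fps_X ^ 3 - fps_const (of_nat (p - 1) * of_real v) * fps_X ^ p) =
      1 + fps_X ^ 3 + fps_const (of_real v) * fps_X ^ p"
    using path_sum_gf[of p x] unfolding E poly_D poly_E P_def .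
  have rec: "path_sum p x n = (if n < 3 then 0 else 2 * path_sum p x (n - 3)) +
      (if n < p then 0 else of_nat (p - 1) * of_real v * path_sum p x (n - p)) +
      (if n = 0 then 1 else 0) + (if n = 3 then 1 else 0) + (if n = p then of_real v else 0)" for n
  proof -
    have e: "P * (1 - fps_const 2 * fps_X ^ 3 - fps_const (of_nat (p - 1) * of_real v) * fps_X ^ p) =
       P - fps_const 2 * (fps_X ^ 3 * P) - fps_const (of_nat (p - 1) * of_real v) * (fps_X ^ p * P)"
      by (simp add: algebra_simps)
    have "fps_nth (P - fps_const 2 * (fps_X ^ 3 * P) - fps_const (of_nat (p - 1) * of_real v) * (fps_X ^ p * P)) n =
       fps_nth (1 + fps_X ^ 3 + fps_const (of_real v) * fps_X ^ p) n"
      using gf unfolding e by simp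
    then show ?thesis
      using p by (simp add: fps_X_power_mult_nth P_def fps_X_power_nth split: if_splits) (auto simp: algebra_simps)
  qed
  show ?thesis
  proof (induction n rule: less_induct)
    case (less n)
    show ?case
      using p by (subst rec, subst path_poly.simps) (auto simp: less of_nat_diff)
  qed
qed

text \<open>A part other than 3 and \<open>p\<close> kills the product, a part 3 contributes 1 and a
  part \<open>p\<close> contributes \<open>v\<close>. Zero parts are excluded since
  \<open>e_0 = 1\<close>.\<close>

lemma prod_list_specialised:
  assumes p: "4 \<le> p" and "0 \<notin> set ps"
    and E: "(\<Prod>i<p. [:1, x i:]) = 1 + monom 1 3 + monom (of_real v) p"
  shows "prod_list (map (esym p x) ps) =
    (of_real (if set ps \<subseteq> {3, p} then v ^ count_list ps p else 0) :: complex)"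
proof -
  have "esym p x k = (if k = 3 then 1 else if k = p then of_real v else 0)" if "k \<noteq> 0" for k
    using that p unfolding coeff_prod_linear_factors[symmetric] E by simp
  with assms(2) show ?thesis
    using p by (induction ps) auto
qed

lemma poly_eqI_real:
  fixes P Q :: "real poly"
  assumes "\<And>v. poly P v = poly Q v"
  shows "P = Q"
  using assms by (simp add: poly_eq_poly_eq_iff[symmetric] fun_eq_iff)

text \<open>The specialised spider and the specialised e-expansion agree at every real
  \<open>v\<close>, hence as polynomials in \<open>v\<close>; the latter is a sum of monomials with
  nonnegative coefficients.\<close>

lemma spider_coeff_nonneg:
  assumes "spider_e_positive a b 2" and p: "4 \<le> p"
  shows "0 \<le> coeff (path_poly p (a + b + 3) - path_poly p (a + 1) * path_poly p (b + 2)
      - path_poly p (a + 2) * path_poly p (b + 1)) j"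
proof -
  let ?S = "path_poly p (a + b + 3) - path_poly p (a + 1) * path_poly p (b + 2)
      - path_poly p (a + 2) * path_poly p (b + 1)"
  let ?V = "spider_verts a b 2"
  obtain c where c: "\<And>ps. ps \<in> partitions_of (card ?V) \<Longrightarrow> 0 \<le> (c ps :: real)"
    and eq: "\<And>N (x :: nat \<Rightarrow> complex). (\<Sum>\<kappa>\<in>colourings N ?V (spider_adj a b 2). \<Prod>v\<in>?V. x (\<kappa> v)) =
       (\<Sum>ps\<in>partitions_of (card ?V). of_real (c ps) * prod_list (map (esym N x) ps))"
    using e_positive_specialise[OF assms(1)[unfolded spider_e_positive_def] finite_spider_verts] by blast
  define R where "R = (\<Sum>ps\<in>partitions_of (card ?V).
      if set ps \<subseteq> {3, p} then monom (c ps) (count_list ps p) else 0)"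
  have "poly ?S v = poly R v" for v
  proof -
    obtain x :: "nat \<Rightarrow> complex"
      where E: "(\<Prod>i<p. [:1, x i:]) = 1 + monom 1 3 + monom (of_real v) p"
      using specialisation_exists[OF p] by metis
    note P = path_sum_eq_path_poly[OF p E]
    have small: "path_poly p 1 = 0" "path_poly p 2 = 0"
      using p by (simp_all add: path_poly.simps)
    have "complex_of_real (poly ?S v) = path_sum p x (a + b + 3) - path_sum p x (a + 1) * path_sum p x (b + 2)
      - path_sum p x (a + 2) * path_sum p x (b + 1)"
      unfolding P by simp
    also have "\<dots> = (\<Sum>ps\<in>partitions_of (card ?V). of_real (c ps) * prod_list (map (esym p x) ps))"
      unfolding eq[symmetric] spider_colouring_sum
      by (rule spider_sum_path_sums[symmetric]) (simp_all add: P small small[unfolded One_nat_def])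
    also have "\<dots> = (\<Sum>ps\<in>partitions_of (card ?V). of_real (c ps * (if set ps \<subseteq> {3, p} then v ^ count_list ps p else 0)))"
      by (intro sum.cong refl) (simp add: prod_list_specialised[OF p _ E] partitions_of_def)
    also have "\<dots> = complex_of_real (poly R v)"
      unfolding R_def poly_sum of_real_sum by (intro sum.cong refl) (simp add: poly_monom)
    finally show ?thesis by (simp only: of_real_eq_iff)
  qed
  then have "?S = R" by (rule poly_eqI_real)
  moreover have "0 \<le> coeff R j"
    unfolding R_def coeff_sum using c by (intro sum_nonneg) auto
  ultimately show ?thesis by simp
qed

section \<open>Coefficients of the path polynomials\<close>

text \<open>\<open>path_coeff (p - 1) m j\<close> is the coefficient of \<open>e\<^sub>3\<^sup>m e\<^sub>p\<^sup>j\<close> in the chromatic symmetric function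
of a path.\<close>

fun path_coeff :: "real \<Rightarrow> nat \<Rightarrow> nat \<Rightarrow> real" where
  "path_coeff q 0 0 = 1"
| "path_coeff q (Suc m) 0 = 3 * 2 ^ m"
| "path_coeff q 0 (Suc j) = (q + 1) * q ^ j"
| "path_coeff q (Suc m) (Suc j) = 2 * path_coeff q m (Suc j) + q * path_coeff q (Suc m) j"

text \<open>Homogeneity: \<open>e_3^m * e_p^j\<close> has degree
  \<open>3 * m + p * j\<close>.\<close>

lemma coeff_path_poly_eq_0:
  assumes "\<nexists>m. n = 3 * m + p * j"
  shows "coeff (path_poly p n) j = 0"
  using assms
proof (induction n arbitrary: j rule: less_induct)
  case (less n)
  have "n \<noteq> 0 \<or> j \<noteq> 0" using less.prems[unfolded not_ex, rule_format, of 0] by auto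
  moreover have "n \<noteq> 3 \<or> j \<noteq> 0" using less.prems[unfolded not_ex, rule_format, of 1] by auto
  moreover have "n \<noteq> p \<or> j \<noteq> 1" using less.prems[unfolded not_ex, rule_format, of 0] by auto
  moreover have "coeff (path_poly p (n - 3)) j = 0" if "3 \<le> n"
  proof (rule less.IH)
    show "\<nexists>m. n - 3 = 3 * m + p * j"
    proof
      assume "\<exists>m. n - 3 = 3 * m + p * j"
      then obtain m where "n - 3 = 3 * m + p * j" ..
      then have "n = 3 * Suc m + p * j" using that by simp
      then show False using less.prems by blast
    qed
  qed (use that in simp)
  moreover have "coeff (path_poly p (n - p)) i = 0" if "p \<le> n" "0 < p" "j = Suc i" for i
  proof (rule less.IH)
    show "\<nexists>m. n - p = 3 * m + p * i"
    proof
      assume "\<exists>m. n - p = 3 * m + p * i"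
      then obtain m where "n - p = 3 * m + p * i" ..
      then have "n = 3 * m + p * j" using that by simp
      then show False using less.prems by blast
    qed
  qed (use that in simp)
  ultimately show ?case
    by (subst path_poly.simps) (cases j; auto simp: coeff_pCons split: nat.splits)
qed

text \<open>Induction along the recursion of \<open>path_coeff\<close>. The boundaries
  \<open>j = 0\<close> and \<open>m = 0\<close> need their own inductions, as the extra terms at
  lengths 3 and \<open>p\<close> enter only there and produce the factors 3 and
  \<open>q + 1\<close>.\<close>

lemma coeff_path_poly:
  assumes "4 \<le> p"
  shows "coeff (path_poly p (3 * m + p * j)) j = path_coeff (real p - 1) m j"
proof (induction "real p - 1" m j rule: path_coeff.induct)
  case 1
  show ?case by (simp add: path_poly.simps)
next
  case (2 m)
  have "coeff (path_poly p (3 * n)) 0 = (if n = 0 then 1 else 3 * 2 ^ (n - 1))" for n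
  proof (induction n)
    case 0
    show ?case by (simp add: path_poly.simps)
  next
    case (Suc n)
    then show ?case
      using assms by (subst path_poly.simps) (cases n; simp)
  qed
  from this[of "Suc m"] show ?case by simp
next
  case (3 j)
  have "coeff (path_poly p (p * n)) n = path_coeff (real p - 1) 0 n" for n
  proof (induction n)
    case 0
    show ?case by (simp add: path_poly.simps)
  next
    case (Suc n)
    \<comment> \<open>Removing an \<open>e_3\<close> leaves too small a degree for
      \<open>Suc n\<close> factors \<open>e_p\<close>.\<close>
    have "coeff (path_poly p (p * Suc n - 3)) (Suc n) = 0"
    proof (rule coeff_path_poly_eq_0)
      have "p * Suc n - 3 < p * Suc n" using assms by simp
      then show "\<nexists>m. p * Suc n - 3 = 3 * m + p * Suc n" by linarith
    qed
    then show ?case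
      using Suc assms by (subst path_poly.simps) (cases n; auto simp: algebra_simps)
  qed
  from this[of "Suc j"] show ?case by simp
next
  case (4 m j)
  then show ?case
    using assms by (subst path_poly.simps) (auto simp: algebra_simps)
qed

subsection \<open>Explicit coefficients\<close>

text \<open>The recursion with \<open>j - 1\<close> in place of \<open>Suc\<close>, so that it
  rewrites at numerals.\<close>

lemma path_coeff_rec:
  assumes "0 < j"
  shows "path_coeff q 0 j = (q + 1) * q ^ (j - 1)"
    "path_coeff q (Suc m) j = 2 * path_coeff q m j + q * path_coeff q (Suc m) (j - 1)"
  using assms by (cases j; simp)+

text \<open>Write \<open>f j m\<close> for \<open>path_coeff q m j / 2^m\<close>. For positive
  \<open>j\<close> the recursion becomes \<open>f j (m + 1) = f j m + q * f (j - 1) (m + 1)\<close>,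
  so \<open>f j\<close> is a polynomial of degree \<open>j\<close> in \<open>m\<close> with value
  \<open>(q + 1) * q^(j - 1)\<close> at 0. The closed forms below, for \<open>q = 3\<close> and
  \<open>q = 4\<close>, follow one from another.\<close>

lemma path_coeff_3_1: "path_coeff 3 m 1 = 2 ^ m * (9/2 * real m + 4)"
  by (induction m) (simp_all add: path_coeff_rec field_simps)

lemma path_coeff_3_2:
  "path_coeff 3 m 2 = 2 ^ m * (27/4 * real m ^ 2 + 75/4 * real m + 12)"
  by (induction m) (simp_all add: path_coeff_rec[of 2] path_coeff_3_1[unfolded One_nat_def] field_simps power_numeral_reduce)

lemma path_coeff_3_3:
  "path_coeff 3 m 3 = 2 ^ m * (27/4 * real m ^ 3 + 153/4 * real m ^ 2 + 135/2 * real m + 36)"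
  by (induction m) (simp_all add: path_coeff_rec[of 3] path_coeff_3_2 field_simps power_numeral_reduce)

lemma path_coeff_3_4:
  "path_coeff 3 m 4 = 2 ^ m *
     (81/16 * real m ^ 4 + 387/8 * real m ^ 3 + 2619/16 * real m ^ 2 + 1827/8 * real m + 108)"
  by (induction m) (simp_all add: path_coeff_rec[of 4] path_coeff_3_3 field_simps power_numeral_reduce)

lemma path_coeff_3_5:
  "path_coeff 3 m 5 = 2 ^ m *
     (243/80 * real m ^ 5 + 351/8 * real m ^ 4 + 3861/16 * real m ^ 3 + 4995/8 * real m ^ 2 +
      7479/10 * real m + 324)"
  by (induction m) (simp_all add: path_coeff_rec[of 5] path_coeff_3_4 field_simps power_numeral_reduce)

lemma path_coeff_3_6:
  "path_coeff 3 m 6 = 2 ^ m *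
     (243/160 * real m ^ 6 + 4941/160 * real m ^ 5 + 8019/32 * real m ^ 4 + 32967/32 * real m ^ 3 +
      179091/80 * real m ^ 2 + 48033/20 * real m + 972)"
  by (induction m) (simp_all add: path_coeff_rec[of 6] path_coeff_3_5 field_simps power_numeral_reduce)

lemma path_coeff_4_1: "path_coeff 4 m 1 = 2 ^ m * (6 * real m + 5)"
  by (induction m) (simp_all add: path_coeff_rec field_simps)

lemma path_coeff_4_2: "path_coeff 4 m 2 = 2 ^ m * (12 * real m ^ 2 + 32 * real m + 20)"
  by (induction m) (simp_all add: path_coeff_rec[of 2] path_coeff_4_1[unfolded One_nat_def] field_simps power_numeral_reduce)

lemma coeff_path_poly_mod_3:
  assumes "n mod 3 \<noteq> p * j mod 3"
  shows "coeff (path_poly p n) j = 0"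
  by (rule coeff_path_poly_eq_0) (use assms in auto)

lemma coeff_path_poly_short:
  assumes "n < p * j"
  shows "coeff (path_poly p n) j = 0"
  by (rule coeff_path_poly_eq_0) (use assms in auto)

lemma coeff_path_poly_4:
  "n = 3 * m + 4 * j \<Longrightarrow> coeff (path_poly 4 n) j = path_coeff 3 m j"
  using coeff_path_poly[of 4 m j] by simp

lemma coeff_path_poly_5:
  "n = 3 * m + 5 * j \<Longrightarrow> coeff (path_poly 5 n) j = path_coeff 4 m j"
  using coeff_path_poly[of 5 m j] by simp

text \<open>Length 0 is excluded because its coefficient is 1 rather than
  \<open>3 / 2\<close>.\<close>

lemma coeff_path_poly_p_0:
  assumes "4 \<le> p" "1 \<le> n"
  shows "coeff (path_poly p (3 * n)) 0 = 2 ^ n * (3 / 2)"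
  using coeff_path_poly[of p n 0] assms by (cases n) auto

text \<open>In this and the following lemmas the shift of \<open>n\<close> is the number of factors
  \<open>e_3\<close> displaced by the \<open>e_p\<close>, here
  \<open>3 * n + 1 = 3 * (n - 1) + 4\<close>. The common factor \<open>2 ^ n\<close> is extracted so
  that the powers cancel in products.\<close>

lemma coeff_4_1:
  assumes "1 \<le> n"
  shows "coeff (path_poly 4 (3 * n + 1)) 1 = 2 ^ n / 2 * (9/2 * (real n - 1) + 4)"
proof -
  have "coeff (path_poly 4 (3 * n + 1)) 1 = path_coeff 3 (n - 1) 1"
    using assms by (intro coeff_path_poly_4) simp
  then show ?thesis using assms by (simp add: path_coeff_3_1[unfolded One_nat_def] power_diff of_nat_diff)
qed

lemma coeff_4_2:
  assumes "2 \<le> n"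
  shows "coeff (path_poly 4 (3 * n + 2)) 2 =
    2 ^ n / 4 * (27/4 * (real n - 2) ^ 2 + 75/4 * (real n - 2) + 12)"
proof -
  have "coeff (path_poly 4 (3 * n + 2)) 2 = path_coeff 3 (n - 2) 2"
    using assms by (intro coeff_path_poly_4) simp
  then show ?thesis using assms by (simp add: path_coeff_3_2 power_diff of_nat_diff)
qed

lemma coeff_4_3:
  assumes "4 \<le> n"
  shows "coeff (path_poly 4 (3 * n)) 3 =
    2 ^ n / 16 * (27/4 * (real n - 4) ^ 3 + 153/4 * (real n - 4) ^ 2 + 135/2 * (real n - 4) + 36)"
proof -
  have "coeff (path_poly 4 (3 * n)) 3 = path_coeff 3 (n - 4) 3"
    using assms by (intro coeff_path_poly_4) simp
  then show ?thesis using assms by (simp add: path_coeff_3_3 power_diff of_nat_diff)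
qed

text \<open>The formula also holds at \<open>n = 4\<close>, where the path is too short: the quartic
  vanishes at -1. This value is needed for \<open>k = 4\<close>.\<close>

lemma coeff_4_4:
  assumes "4 \<le> n"
  shows "coeff (path_poly 4 (3 * n + 1)) 4 =
    2 ^ n / 32 * (81/16 * (real n - 5) ^ 4 + 387/8 * (real n - 5) ^ 3 + 2619/16 * (real n - 5) ^ 2 +
      1827/8 * (real n - 5) + 108)"
proof (cases "n = 4")
  case True
  then show ?thesis by (simp add: coeff_path_poly_short)
next
  case False
  then have "coeff (path_poly 4 (3 * n + 1)) 4 = path_coeff 3 (n - 5) 4"
    using assms by (intro coeff_path_poly_4) simp
  then show ?thesis using assms False by (simp add: path_coeff_3_4 power_diff of_nat_diff)
qed

text \<open>The quintic vanishes at -2 and -1, which covers the too short paths \<open>n = 4\<close>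
  and \<open>n = 5\<close>.\<close>

lemma coeff_4_5:
  assumes "4 \<le> n"
  shows "coeff (path_poly 4 (3 * n + 2)) 5 =
    2 ^ n / 64 * (243/80 * (real n - 6) ^ 5 + 351/8 * (real n - 6) ^ 4 + 3861/16 * (real n - 6) ^ 3 +
      4995/8 * (real n - 6) ^ 2 + 7479/10 * (real n - 6) + 324)"
proof (cases "n = 4 \<or> n = 5")
  case True
  then show ?thesis by (auto simp: coeff_path_poly_short)
next
  case False
  then have "6 \<le> n" using assms by simp
  then have "coeff (path_poly 4 (3 * n + 2)) 5 = path_coeff 3 (n - 6) 5"
    using assms by (intro coeff_path_poly_4) simp
  then show ?thesis using assms False by (simp add: path_coeff_3_5 power_diff of_nat_diff)
qed

lemma coeff_4_6:
  assumes "8 \<le> n"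
  shows "coeff (path_poly 4 (3 * n)) 6 =
    2 ^ n / 256 * (243/160 * (real n - 8) ^ 6 + 4941/160 * (real n - 8) ^ 5 + 8019/32 * (real n - 8) ^ 4 +
      32967/32 * (real n - 8) ^ 3 + 179091/80 * (real n - 8) ^ 2 + 48033/20 * (real n - 8) + 972)"
proof -
  have "coeff (path_poly 4 (3 * n)) 6 = path_coeff 3 (n - 8) 6"
    using assms by (intro coeff_path_poly_4) simp
  then show ?thesis using assms by (simp add: path_coeff_3_6 power_diff of_nat_diff)
qed

lemma coeff_5_1:
  assumes "1 \<le> n"
  shows "coeff (path_poly 5 (3 * n + 2)) 1 = 2 ^ n / 2 * (6 * (real n - 1) + 5)"
proof -
  have "coeff (path_poly 5 (3 * n + 2)) 1 = path_coeff 4 (n - 1) 1"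
    using assms by (intro coeff_path_poly_5) simp
  then show ?thesis using assms by (simp add: path_coeff_4_1[unfolded One_nat_def] power_diff of_nat_diff)
qed

lemma coeff_5_2:
  assumes "3 \<le> n"
  shows "coeff (path_poly 5 (3 * n + 1)) 2 =
    2 ^ n / 8 * (12 * (real n - 3) ^ 2 + 32 * (real n - 3) + 20)"
proof -
  have "coeff (path_poly 5 (3 * n + 1)) 2 = path_coeff 4 (n - 3) 2"
    using assms by (intro coeff_path_poly_5) simp
  then show ?thesis using assms by (simp add: path_coeff_4_2 power_diff of_nat_diff)
qed

lemma coeff_mult_2:
  "coeff (A * B) 2 = coeff A 0 * coeff B 2 + coeff A 1 * coeff B 1 + coeff A 2 * coeff B 0"
  by (simp add: coeff_mult eval_nat_numeral)

lemma coeff_mult_3: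
  "coeff (A * B) 3 = coeff A 0 * coeff B 3 + coeff A 1 * coeff B 2 + coeff A 2 * coeff B 1 +
     coeff A 3 * coeff B 0"
  by (simp add: coeff_mult eval_nat_numeral)

lemma coeff_mult_6:
  "coeff (A * B) 6 = coeff A 0 * coeff B 6 + coeff A 1 * coeff B 5 + coeff A 2 * coeff B 4 +
     coeff A 3 * coeff B 3 + coeff A 4 * coeff B 2 + coeff A 5 * coeff B 1 + coeff A 6 * coeff B 0"
  by (simp add: coeff_mult eval_nat_numeral)

text \<open>The zero coefficients that make the product expansions below collapse to one or two
  terms.\<close>

lemma coeff_path_poly_mod_3_numeral: "coeff (path_poly 4 (3 * n + 1)) 0 = 0" "coeff (path_poly 4 (3 * n + 1)) 2 = 0"
  "coeff (path_poly 4 (3 * n + 1)) 3 = 0" "coeff (path_poly 4 (3 * n + 1)) 5 = 0"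
  "coeff (path_poly 4 (3 * n + 1)) 6 = 0"
  "coeff (path_poly 4 (3 * n + 2)) 0 = 0" "coeff (path_poly 4 (3 * n + 2)) 1 = 0"
  "coeff (path_poly 4 (3 * n + 2)) 3 = 0" "coeff (path_poly 4 (3 * n + 2)) 4 = 0"
  "coeff (path_poly 4 (3 * n + 2)) 6 = 0"
  "coeff (path_poly 4 (3 * n)) 1 = 0" "coeff (path_poly 4 (3 * n)) 2 = 0"
  "coeff (path_poly 5 (3 * n + 1)) 0 = 0" "coeff (path_poly 5 (3 * n + 1)) 1 = 0"
  "coeff (path_poly 5 (3 * n + 2)) 0 = 0" "coeff (path_poly 5 (3 * n + 2)) 2 = 0"
  "coeff (path_poly 5 (3 * n)) 1 = 0" "coeff (path_poly 5 (3 * n)) 2 = 0"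
  by (rule coeff_path_poly_mod_3, simp add: mod_Suc)+

subsection \<open>Bounds from individual coefficients\<close>

text \<open>Up to a positive factor, these are the coefficients of \<open>e\<^sub>4\<^sup>3 e\<^sub>3\<^sup>m\<close> and \<open>e\<^sub>4\<^sup>6 e\<^sub>3\<^sup>m\<close>
for the spider \<open>S(3y,3x,2)\<close>.\<close>

definition e4_cubed_form :: "real \<Rightarrow> real \<Rightarrow> real" where
  "e4_cubed_form x y = 18 * x ^ 3 - 27 * x ^ 2 * y - 27 * x * y ^ 2 + 18 * y ^ 3 - 51 * x ^ 2 + 78 * x * y - 51 * y
    ^ 2 + 25 * x + 25 * y - 8"

definition e4_sixth_form :: "real \<Rightarrow> real \<Rightarrow> real" where
  "e4_sixth_form x y = 18 * x ^ 6 - 54 * x ^ 5 * y - 135 * x ^ 4 * y ^ 2 + 360 * x ^ 3 * y ^ 3 - 135 * x ^ 2 * y ^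
    4 - 54 * x * y ^ 5 + 18 * y ^ 6 - 372 * x ^ 5 + 1065 * x ^ 4 * y + 330 * x ^ 3 * y ^ 2 + 330
    * x ^ 2 * y ^ 3 + 1065 * x * y ^ 4 - 372 * y ^ 5 + 3020 * x ^ 4 - 6640 * x ^ 3 * y - 11250 *
    x ^ 2 * y ^ 2 - 6640 * x * y ^ 3 + 3020 * y ^ 4 - 12480 * x ^ 3 + 41805 * x ^ 2 * y + 41805
    * x * y ^ 2 - 12480 * y ^ 3 + 13882 * x ^ 2 - 105052 * x * y + 13882 * y ^ 2 + 15132 * x +
    15132 * y + 8640"

lemma nonneg_of_scaled_nonneg:
  fixes F :: real
  assumes "0 \<le> 2 ^ n * (c * F)" "0 < c"
  shows "0 \<le> F"
proof (rule ccontr)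
  assume "\<not> 0 \<le> F"
  then have "2 ^ n * (c * F) < 0"
    using assms(2) by (intro mult_pos_neg) (auto intro: mult_pos_neg)
  then show False using assms(1) by simp
qed

text \<open>Modulo 3, the exponent of \<open>e_4\<close> is 1 in the first kind of factor and 2 in
  the second, so each product contributes only \<open>e_4 * e_4^2\<close>.\<close>

lemma spider_e4_cubed_nonneg:
  assumes "spider_e_positive (3 * l) (3 * k) 2" "4 \<le> k" "k \<le> l"
  shows "0 \<le> e4_cubed_form (real k) (real l)"
proof -
  have n: "3 * l + 3 * k + 3 = 3 * (k + l + 1)" by simp
  have le: "1 \<le> k" "1 \<le> l" "2 \<le> k" "2 \<le> l" "4 \<le> k + l + 1"
    using assms(2,3) by auto
  have c: "coeff (path_poly 4 (3 * (k + l + 1)) - path_poly 4 (3 * l + 1) * path_poly 4 (3 * k + 2)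
      - path_poly 4 (3 * l + 2) * path_poly 4 (3 * k + 1)) 3 = 2 ^ (k + l) * (3/64 * e4_cubed_form (real k) (real l))"
    unfolding coeff_diff coeff_mult_3 e4_cubed_form_def coeff_path_poly_mod_3_numeral coeff_4_1[OF le(1)] coeff_4_1[OF le(2)] coeff_4_2[OF le(3)]
      coeff_4_2[OF le(4)] coeff_4_3[OF le(5)]
    by (simp add: power_add) (simp add: field_simps power_numeral_reduce)
  show ?thesis
    using spider_coeff_nonneg[OF assms(1) order.refl, of 3] unfolding n c
    by (rule nonneg_of_scaled_nonneg) simp
qed

text \<open>The exponent 6 splits only as \<open>1 + 5\<close> and \<open>4 + 2\<close> by the
  residues modulo 3.\<close>

lemma spider_e4_sixth_nonneg:
  assumes "spider_e_positive (3 * l) (3 * k) 2" "4 \<le> k" "k \<le> l"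
  shows "0 \<le> e4_sixth_form (real k) (real l)"
proof -
  have n: "3 * l + 3 * k + 3 = 3 * (k + l + 1)" by simp
  have le: "1 \<le> k" "1 \<le> l" "2 \<le> k" "2 \<le> l" "4 \<le> l" "8 \<le> k + l + 1"
    using assms(2,3) by auto
  have c: "coeff (path_poly 4 (3 * (k + l + 1)) - path_poly 4 (3 * l + 1) * path_poly 4 (3 * k + 2)
      - path_poly 4 (3 * l + 2) * path_poly 4 (3 * k + 1)) 6 = 2 ^ (k + l) * (27/40960 * e4_sixth_form (real k) (real l))"
    unfolding coeff_diff coeff_mult_6 e4_sixth_form_def coeff_path_poly_mod_3_numeral coeff_4_1[OF le(1)] coeff_4_1[OF le(2)] coeff_4_2[OF le(3)]
      coeff_4_2[OF le(4)] coeff_4_4[OF assms(2)] coeff_4_4[OF le(5)] coeff_4_5[OF assms(2)] coeff_4_5[OF le(5)] coeff_4_6[OF le(6)]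
    by (simp add: power_add) (simp add: field_simps power_numeral_reduce)
  show ?thesis
    using spider_coeff_nonneg[OF assms(1) order.refl, of 6] unfolding n c
    by (rule nonneg_of_scaled_nonneg) simp
qed

text \<open>The coordinates \<open>s\<close> and \<open>t\<close> measure the distance to the ends
  \<open>l = k\<close> and \<open>l = 2 * k + 1\<close> of the range. In them the cubic part has
  only negative coefficients but vanishes on \<open>t = 0\<close>, where the quadratic part
  decides.\<close>

lemma e4_cubed_form_neg:
  assumes "4 \<le> k" "k \<le> l" "l \<le> 2 * k + 1"
  shows "e4_cubed_form (real k) (real l) < 0"
proof -
  define s where "s = real l - real k"
  define t where "t = 2 * real k + 1 - real l"
  have kl: "real k = s + t - 1" "real l = 2 * s + t - 1"
    by (simp_all add: s_def t_def)
  \<comment> \<open>Integrality enters here: away from the two edges, \<open>s\<close> and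
    \<open>t\<close> are each bounded by \<open>s * t\<close>.\<close>
  have s: "s = 0 \<or> 1 \<le> s" and t: "t = 0 \<or> 1 \<le> t" and st: "5 \<le> s + t"
  proof -
    have "l = k \<or> k + 1 \<le> l" and "l = 2 * k + 1 \<or> l \<le> 2 * k" using assms by auto
    then show "s = 0 \<or> 1 \<le> s" "t = 0 \<or> 1 \<le> t" unfolding s_def t_def by auto
    show "5 \<le> s + t" using assms by (simp add: s_def t_def)
  qed
  have eq: "e4_cubed_form (s + t - 1) (2 * s + t - 1) =
    -81 * s ^ 2 * t - 81 * s * t ^ 2 - 18 * t ^ 3 - 18 * s ^ 2 + 90 * s * t + 30 * t ^ 2 + 66 *
    s + 44 * t - 64"
    unfolding e4_cubed_form_def by (simp add: field_simps power_numeral_reduce)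
  consider "s = 0" "5 \<le> t" | "t = 0" "5 \<le> s" | "1 \<le> s" "1 \<le> t"
    using s t st by fastforce
  then show ?thesis
  proof cases
    case 1
    have "0 \<le> t ^ 2 * (t - 5)" using 1 by simp
    then have "5 * t ^ 2 \<le> t ^ 3" by (simp add: algebra_simps power_numeral_reduce)
    moreover have "5 * t \<le> t ^ 2" using 1 by (simp add: power2_eq_square)
    ultimately show ?thesis unfolding kl eq using 1 by simp
  next
    case 2
    have "5 * s \<le> s ^ 2" using 2 by (simp add: power2_eq_square)
    then show ?thesis unfolding kl eq using 2 by simp
  next
    case 3
    \<comment> \<open>The terms with coefficient -81 thus give at most \<open>-405 * s * t\<close>,
      which absorbs \<open>90 * s * t\<close> and the linear terms; the next step handles
      \<open>30 * t^2\<close> by completing a square.\<close>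
    have "0 \<le> (s * t) * (s + t - 5)" using 3 st by simp
    then have "5 * (s * t) \<le> s ^ 2 * t + s * t ^ 2" by (simp add: algebra_simps power2_eq_square)
    moreover have "0 \<le> t * (18 * (t - 5/6) ^ 2 + 15/2)" using 3 by simp
    then have "30 * t ^ 2 \<le> 18 * t ^ 3 + 20 * t" by (simp add: field_simps power_numeral_reduce)
    moreover have "s \<le> s * t" "t \<le> s * t" using 3 by simp_all
    moreover have "0 \<le> s ^ 2" by simp
    ultimately show ?thesis unfolding kl eq using 3 by linarith
  qed
qed

text \<open>The coordinates \<open>s\<close> and \<open>t\<close> vanish at the two ends of the
  range of \<open>l\<close>. After the substitution only \<open>s * t^4\<close>, \<open>t^5\<close>
  and \<open>t^4\<close> have positive coefficients, and the constant term is negative.\<close>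

lemma e4_sixth_form_neg:
  assumes "4 \<le> k" "2 * k + 2 \<le> l" "l \<le> 3 * k"
  shows "e4_sixth_form (real k) (real l) < 0"
proof -
  define s where "s = real l - 2 * real k - 2"
  define t where "t = 3 * real k - real l"
  have st: "0 \<le> s" "0 \<le> t"
    using assms by (simp_all add: s_def t_def)
  have kl: "real k = s + t + 2" "real l = 3 * s + 2 * t + 6"
    by (simp_all add: s_def t_def)
  have eq: "e4_sixth_form (s + t + 2) (3 * s + 2 * t + 6) =
    -2574 * s ^ 6 - 14094 * s ^ 5 * t - 28755 * s ^ 4 * t ^ 2 - 29160 * s ^ 3 * t ^ 3 - 15795 *
    s ^ 2 * t ^ 4 - 4374 * s * t ^ 5 - 486 * t ^ 6 - 20316 * s ^ 5 - 64395 * s ^ 4 * t - 69210 *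
    s ^ 3 * t ^ 2 - 25650 * s ^ 2 * t ^ 3 + 1755 * s * t ^ 4 + 2106 * t ^ 5 - 101530 * s ^ 4 -
    235380 * s ^ 3 * t - 168150 * s ^ 2 * t ^ 2 - 27600 * s * t ^ 3 + 6630 * t ^ 4 - 259220 * s
    ^ 3 - 493335 * s ^ 2 * t - 287445 * s * t ^ 2 - 47370 * t ^ 3 - 302456 * s ^ 2 - 412812 * s
    * t - 136584 * t ^ 2 - 156544 * s - 110616 * t - 29280"
    unfolding e4_sixth_form_def by (simp add: field_simps power_numeral_reduce)
  \<comment> \<open>Completing the square: the neighbours \<open>s * t^5\<close> and
    \<open>s * t^3\<close> dominate \<open>s * t^4\<close>.\<close>
  have "0 \<le> s * t ^ 3 * (4374 * (t - 65/324) ^ 2 + 658175/24)"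
    using st by simp
  then have "1755 * (s * t ^ 4) \<le> 4374 * (s * t ^ 5) + 27600 * (s * t ^ 3)"
    by (simp add: field_simps power_numeral_reduce)
  \<comment> \<open>Likewise \<open>t^6\<close> and \<open>t^3\<close> dominate \<open>t^5\<close>
    and \<open>t^4\<close>: the cubic cofactor is \<open>486 * t * (t - 4)^2\<close> plus a positive
    quadratic.\<close>
  moreover have "0 \<le> t ^ 3 * (486 * t * (t - 4) ^ 2 + 1782 * (t - 2401/594) ^ 2 + 3614459/198)"
    using st by simp
  then have "2106 * t ^ 5 + 6630 * t ^ 4 \<le> 486 * t ^ 6 + 47370 * t ^ 3"
    by (simp add: field_simps power_numeral_reduce)
  moreover have "0 \<le> s ^ 6" "0 \<le> s ^ 5 * t" "0 \<le> s ^ 5" "0 \<le> s ^ 4 * t ^ 2" "0 \<le> s ^ 4 *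
      t" "0 \<le> s ^ 4" "0 \<le> s ^ 3 * t ^ 3" "0 \<le> s ^ 3 * t ^ 2" "0 \<le> s ^ 3 * t" "0
      \<le> s ^ 3" "0 \<le> s ^ 2 * t ^ 4" "0 \<le> s ^ 2 * t ^ 3" "0 \<le> s ^ 2 * t ^ 2" "0
      \<le> s ^ 2 * t" "0 \<le> s ^ 2" "0 \<le> s * t ^ 5" "0 \<le> s * t ^ 4" "0 \<le> s * t ^ 3"
      "0 \<le> s * t ^ 2" "0 \<le> s * t" "0 \<le> s" "0 \<le> t ^ 6" "0 \<le> t ^ 5" "0 \<le> t ^
      4" "0 \<le> t ^ 3" "0 \<le> t ^ 2" "0 \<le> t"
    using st by simp_all
  ultimately show ?thesis
    unfolding kl eq by linarith
qed

text \<open>By residues modulo 3, the first product contributes \<open>1 * e_4^2\<close> and the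
  second \<open>e_4 * e_4\<close>, up to powers of \<open>e_3\<close>.\<close>

lemma spider_e4_squared_nonneg:
  assumes "spider_e_positive (3 * l + 2) (3 * k) 2" "4 \<le> k" "k \<le> l"
  shows "0 \<le> 54 * real l ^ 2 - 54 * real k * real l - 27 * real k ^ 2 + 60 * real l - 3 * real k - 2" (is "0 \<le> ?F")
proof -
  have n: "3 * l + 2 + 3 * k + 3 = 3 * (k + l + 1) + 2" "3 * l + 2 + 1 = 3 * (l + 1)" "3 * l + 2 + 2 = 3 * (l + 1) + 1" by simp_all
  have le: "1 \<le> k" "2 \<le> k" "2 \<le> k + l + 1" "1 \<le> l + 1"
    using assms(2,3) by auto
  have c: "coeff (path_poly 4 (3 * (k + l + 1) + 2) - path_poly 4 (3 * (l + 1)) * path_poly 4 (3 * k + 2)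
      - path_poly 4 (3 * (l + 1) + 1) * path_poly 4 (3 * k + 1)) 2 = 2 ^ (k + l) * (1/16 * ?F)"
    unfolding coeff_diff coeff_mult_2 coeff_path_poly_mod_3_numeral coeff_4_1[OF le(1)] coeff_4_1[OF le(4)] coeff_4_2[OF le(2)]
      coeff_4_2[OF le(3)] coeff_path_poly_p_0[OF order.refl le(4)]
    by (simp add: power_add) (simp add: field_simps power_numeral_reduce)
  show ?thesis
    using spider_coeff_nonneg[OF assms(1) order.refl, of 2] unfolding n c
    by (rule nonneg_of_scaled_nonneg) simp
qed

text \<open>By residues modulo 3, the first product contributes \<open>e_5 * e_5\<close> and the
  second \<open>1 * e_5^2\<close>, up to powers of \<open>e_3\<close>.\<close>

lemma spider_e5_squared_nonneg:
  assumes "spider_e_positive (3 * l + 1) (3 * k) 2" "4 \<le> k" "k \<le> l"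
  shows "0 \<le> 12 * real l ^ 2 - 12 * real k * real l - 6 * real k ^ 2 - 10 * real l + 50 * real k - 45" (is "0 \<le> ?F")
proof -
  have n: "3 * l + 1 + 3 * k + 3 = 3 * (k + l + 1) + 1" "3 * l + 1 + 1 = 3 * l + 2" "3 * l + 1 + 2 = 3 * (l + 1)" by simp_all
  have p5: "4 \<le> (5::nat)" by simp
  have le: "1 \<le> k" "1 \<le> l" "3 \<le> k" "3 \<le> k + l + 1" "1 \<le> l + 1"
    using assms(2,3) by auto
  have c: "coeff (path_poly 5 (3 * (k + l + 1) + 1) - path_poly 5 (3 * l + 2) * path_poly 5 (3 * k + 2)
      - path_poly 5 (3 * (l + 1)) * path_poly 5 (3 * k + 1)) 2 = 2 ^ (k + l) * (1/4 * ?F)"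
    unfolding coeff_diff coeff_mult_2 coeff_path_poly_mod_3_numeral coeff_5_1[OF le(1)] coeff_5_1[OF le(2)] coeff_5_2[OF le(3)]
      coeff_5_2[OF le(4)] coeff_path_poly_p_0[OF p5 le(5)]
    by (simp add: power_add) (simp add: field_simps power_numeral_reduce)
  show ?thesis
    using spider_coeff_nonneg[OF assms(1) p5, of 2] unfolding n c
    by (rule nonneg_of_scaled_nonneg) simp
qed

theorem theorem4p5:
  fixes a b :: nat
  assumes "a \<ge> b" and "b \<ge> 12" and "3 dvd b"
    and "spider_e_positive a b 2"
  shows "(a mod 3 = 0 \<longrightarrow> real a \<ge> 3 * real b + 3) \<and>
         (a mod 3 = 1 \<longrightarrow> real a \<ge> real b / 2 + 9 / 4 + sqrt (12 * (real b)^2 - 180 * real b + 565) / 4) \<and>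
         (a mod 3 = 2 \<longrightarrow> real a \<ge> real b / 2 + 1 / 3 + sqrt (27 * (real b)^2 - 54 * real b + 112) / 6)"
proof (intro conjI impI)
  obtain k where b: "b = 3 * k" using assms(3) by (elim dvdE)
  define l where "l = a div 3"
  have k: "4 \<le> k" and kl: "k \<le> l" using assms(1,2) b by (auto simp: l_def)
  {
    assume "a mod 3 = 0"
    then have a: "a = 3 * l" by (auto simp: l_def)
    note e = assms(4)[unfolded a b] k kl
    \<comment> \<open>By integrality it suffices to exclude \<open>l \<le> 3 * k\<close>; the ranges
      of the two negativity lemmas cover it without a gap.\<close>
    have "3 * k + 1 \<le> l"
    proof (rule ccontr)
      assume "\<not> 3 * k + 1 \<le> l"
      then consider "l \<le> 2 * k + 1" | "2 * k + 2 \<le> l" "l \<le> 3 * k" by linarith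
      then show False
        using spider_e4_cubed_nonneg[OF e] e4_cubed_form_neg[OF k kl]
          spider_e4_sixth_nonneg[OF e] e4_sixth_form_neg[OF k, of l] by cases auto
    qed
    then show "3 * real b + 3 \<le> real a" by (simp add: a b)
  next
    assume "a mod 3 = 1"
    then have a: "a = 3 * l + 1" unfolding l_def by presburger
    \<comment> \<open>The difference of the two sides is 12 times the quadratic in \<open>k\<close>
      and \<open>l\<close>.\<close>
    have "12 * real b ^ 2 - 180 * real b + 565 \<le> (4 * real a - 2 * real b - 9) ^ 2"
      using spider_e5_squared_nonneg[OF assms(4)[unfolded a b] k kl]
      by (simp add: a b power2_eq_square algebra_simps)
    \<comment> \<open>This sign selects the larger root of the quadratic in
      \<open>a\<close>.\<close>
    moreover have "0 \<le> 4 * real a - 2 * real b - 9" using k kl by (simp add: a b)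
    ultimately have "sqrt (12 * real b ^ 2 - 180 * real b + 565) \<le> 4 * real a - 2 * real b - 9"
      by (simp add: real_le_lsqrt)
    then show "real b / 2 + 9 / 4 + sqrt (12 * (real b)^2 - 180 * real b + 565) / 4 \<le> real a" by simp
  next
    assume "a mod 3 = 2"
    then have a: "a = 3 * l + 2" unfolding l_def by presburger
    \<comment> \<open>Here the difference is 6 times the quadratic in \<open>k\<close> and
      \<open>l\<close>.\<close>
    have "27 * real b ^ 2 - 54 * real b + 112 \<le> (6 * real a - 3 * real b - 2) ^ 2"
      using spider_e4_squared_nonneg[OF assms(4)[unfolded a b] k kl]
      by (simp add: a b power2_eq_square algebra_simps)
    moreover have "0 \<le> 6 * real a - 3 * real b - 2" using k kl by (simp add: a b)
    ultimately have "sqrt (27 * real b ^ 2 - 54 * real b + 112) \<le> 6 * real a - 3 * real b - 2"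
      by (simp add: real_le_lsqrt)
    then show "real b / 2 + 1 / 3 + sqrt (27 * (real b)^2 - 54 * real b + 112) / 6 \<le> real a" by simp
  }
qed

end
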